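(* Let $P$ be a probability distribution on $\mathbb N$ with finite mean and $P(1)<1$. Define the operator $T:L(\mathbb R_+;[0,1])\to C^1(\mathbb R_+;[0,1])$ by $$T(f)(x)=\frac1x\sum_{k=1}^\infty P(k)\int_{y=0}^x\left(\int_{z=0}^y\frac{e^{-z}z^{k-1}}{(k-1)!}\,dz+\int_{z=y}^\infty\frac{e^{-z}z^{k-1}}{(k-1)!}\,(f(z))^{k-1}\,dz\right)dy,\qquad x>0,$$ $$T(f)(0)=\sum_{k=1}^\infty P(k)\int_{z=0}^\infty\frac{e^{-z}z^{k-1}}{(k-1)!}(f(z))^{k-1}\,dz,$$ with the convention $0^0=1$. Then the probability of extinction of the Erlang Weighted Tree with potential degree distribution $P$ is $$\mathbb P(\{\text{extinction}\})=\sum_{m=1}^\infty P(m)\int_{0}^\infty\frac{e^{-x}x^m}{m!}(q(x))^m\,dx,$$ where $q\in C^1(\mathbb R_+;[0,1])$ is the smallest fixed point of $T$, i.e. $q=T(q)$ and every other fixed point $f\in C^1(\mathbb R_+;[0,1])$ of $T$ satisfies $f(x)\ge q(x)$ for all $x\in\mathbb R_+$. Equivalently, $q$ is the (pointwise) limit of $T^l(\boldsymbol 0)$ as $l\to\infty$, where $\boldsymbol 0$ is the function identically equal to $0$.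
   Context: $\mathbb N=\{1,2,\dots\}$, $\mathbb Z_+=\{0,1,\dots\}$, $\mathbb R_+=[0,\infty)$. $L(\mathbb R_+;[0,1])$ is the set of Lebesgue measurable functions $\mathbb R_+\to[0,1]$, and $C^1(\mathbb R_+;[0,1])$ the set of continuously differentiable functions $\mathbb R_+\to[0,1]$. $\mathrm{Erlang}(k)$ has density $e^{-x}x^{k-1}/(k-1)!$ on $\mathbb R_+$. **Erlang Weighted Tree (EWT).** Let $\mathbb N^f=\bigcup_{i\ge0}\mathbb N^i$, $\mathbb N^0=\{o\}$, and $\widehat P(k)=P(k+1)$, $k\in\mathbb Z_+$. Independently over $\boldsymbol i\in\mathbb N^f$: $n_o\sim P$, $n_{\boldsymbol i}\sim\widehat P$ for $\boldsymbol i\ne o$; given $n_{\boldsymbol i}$, $v_{\boldsymbol i}\sim\mathrm{Erlang}(n_{\boldsymbol i}+1)$; given $(n_{\boldsymbol i},v_{\boldsymbol i})$, the costs $\zeta_{(\boldsymbol i,1)},\dots,\zeta_{(\boldsymbol i,n_{\boldsymbol i})}$ are i.i.d. uniform on $[0,v_{\boldsymbol i}]$. The backbone tree is the component of $o$ in the graph with (potential) edges $\{\boldsymbol i,(\boldsymbol i,j)\}$, $1\le j\le n_{\boldsymbol i}$. The EWT is the component of the root $o$ after keeping the edge $\{\boldsymbol i,(\boldsymbol i,j)\}$ iff $\zeta_{(\boldsymbol i,j)}<v_{(\boldsymbol i,j)}$. $Z_l$ denotes the number of vertices of the EWT at depth (distance from $o$) $l$, and $\mathbb P(\{\text{extinction}\})=\mathbb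 P(\bigcup_{l\ge1}\{Z_l=0\})$. *)

theory Defs
  imports "HOL-Probability.Probability"
begin

section \<open>Erlang Weighted Trees\<close>

text \<open>
  The index set of finite words over the positive integers; the root is the empty word and
  the \<open>j\<close>-th potential child of \<open>i\<close> is \<open>i @ [j]\<close>.
\<close>

definition words :: "nat list set" where
  "words = lists {1..}"

text \<open>
  Undirected graphs on words are symmetric relations.  The arguments \<open>n\<close>, \<open>v\<close>, \<open>c\<close> below are one
  realisation of the potential child numbers, the thresholds and the costs, where \<open>c (i @ [j])\<close>
  is the cost of the potential edge between \<open>i\<close> and \<open>i @ [j]\<close>.
\<close>

definition component :: "('a \<times> 'a) set \<Rightarrow> 'a \<Rightarrow> 'a set" where
  "component E u = E\<^sup>* `` {u}"

definition graph_dist :: "('a \<times> 'a) set \<Rightarrow> 'a \<Rightarrow> 'a \<Rightarrow> nat" where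
  "graph_dist E u w = (LEAST l. (u, w) \<in> E ^^ l)"

definition potential_edges :: "(nat list \<Rightarrow> nat) \<Rightarrow> (nat list \<times> nat list) set" where
  "potential_edges n =
     (let D = {(i, i @ [j]) | i j. i \<in> words \<and> 1 \<le> j \<and> j \<le> n i} in D \<union> D\<inverse>)"

definition backbone :: "(nat list \<Rightarrow> nat) \<Rightarrow> nat list set" where
  "backbone n = component (potential_edges n) []"

definition kept_edges ::
  "(nat list \<Rightarrow> nat) \<Rightarrow> (nat list \<Rightarrow> real) \<Rightarrow> (nat list \<Rightarrow> real) \<Rightarrow> (nat list \<times> nat list) set" where
  "kept_edges n v c =
     (let D = {(i, i @ [j]) | i j. (i, i @ [j]) \<in> potential_edges n \<inter> backbone n \<times> backbone n \<and>
                                   c (i @ [j]) < v (i @ [j])}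
      in D \<union> D\<inverse>)"

definition ewt :: "(nat list \<Rightarrow> nat) \<Rightarrow> (nat list \<Rightarrow> real) \<Rightarrow> (nat list \<Rightarrow> real) \<Rightarrow> nat list set" where
  "ewt n v c = component (kept_edges n v c) []"

definition Z ::
  "(nat list \<Rightarrow> nat) \<Rightarrow> (nat list \<Rightarrow> real) \<Rightarrow> (nat list \<Rightarrow> real) \<Rightarrow> nat \<Rightarrow> nat" where
  "Z n v c l = card {u \<in> ewt n v c. graph_dist (kept_edges n v c) [] u = l}"

text \<open>The law of the potential child number: \<open>P\<close> at the root, shifted by one elsewhere.\<close>

definition potential_prob :: "nat pmf \<Rightarrow> nat list \<Rightarrow> nat \<Rightarrow> real" where
  "potential_prob P i k = (if i = [] then pmf P k else pmf P (k + 1))"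

text \<open>
  All the randomness attached to \<open>i\<close>.  Only the costs of the first \<open>n i\<close> children exist in the
  model, so the sequence of costs is cut off with zeros.
\<close>

definition mark ::
  "(nat list \<Rightarrow> 'w \<Rightarrow> nat) \<Rightarrow> (nat list \<Rightarrow> 'w \<Rightarrow> real) \<Rightarrow> (nat list \<Rightarrow> 'w \<Rightarrow> real) \<Rightarrow>
     nat list \<Rightarrow> 'w \<Rightarrow> nat \<times> real \<times> (nat \<Rightarrow> real)" where
  "mark n v \<zeta> i \<omega> =
     (n i \<omega>, v i \<omega>, \<lambda>j. if 1 \<le> j \<and> j \<le> n i \<omega> then \<zeta> (i @ [j]) \<omega> else 0)"

text \<open>
  \<open>mark_law\<close> says that \<open>n i\<close> has law \<open>potential_prob P i\<close>; given \<open>n i = k\<close>, the threshold \<open>v i\<close> is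
  Erlang of order \<open>k + 1\<close> (the library's \<open>erlang_density k 1\<close> is
  \<open>exp (- x) * x ^ k / fact k\<close> on the nonnegative reals); given moreover \<open>v i = x\<close>, the \<open>k\<close> costs
  are independent and uniform on \<open>{0..x}\<close>.  Measurability of the marks is part of \<open>indep_vars\<close>.
\<close>

locale erlang_weighted_tree = prob_space M
  for M :: "'w measure" +
  fixes P :: "nat pmf"
    and n :: "nat list \<Rightarrow> 'w \<Rightarrow> nat"
    and v \<zeta> :: "nat list \<Rightarrow> 'w \<Rightarrow> real"
  assumes indep_marks:
    "indep_vars (\<lambda>_. count_space UNIV \<Otimes>\<^sub>M borel \<Otimes>\<^sub>M (\<Pi>\<^sub>M j\<in>UNIV. borel)) (mark n v \<zeta>) words"
  and mark_law:
    "\<And>i k A B. i \<in> words \<Longrightarrow> A \<in> sets borel \<Longrightarrow> (\<And>j. B j \<in> sets borel) \<Longrightarrow>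
       prob {\<omega> \<in> space M. n i \<omega> = k \<and> v i \<omega> \<in> A \<and> (\<forall>j\<in>{1..k}. \<zeta> (i @ [j]) \<omega> \<in> B j)} =
       potential_prob P i k *
         (LINT x:A|lborel. erlang_density k 1 x *
            (\<Prod>j\<in>{1..k}. measure (uniform_measure lborel {0..x}) (B j)))"

definition extinction ::
  "'w measure \<Rightarrow> (nat list \<Rightarrow> 'w \<Rightarrow> nat) \<Rightarrow> (nat list \<Rightarrow> 'w \<Rightarrow> real) \<Rightarrow> (nat list \<Rightarrow> 'w \<Rightarrow> real) \<Rightarrow>
     'w set" where
  "extinction M n v \<zeta> =
     {\<omega> \<in> space M. \<exists>l\<ge>1. Z (\<lambda>i. n i \<omega>) (\<lambda>i. v i \<omega>) (\<lambda>i. \<zeta> i \<omega>) l = 0}"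

section \<open>The operator\<close>

text \<open>
  Functions on the nonnegative reals are represented by functions on \<open>real\<close> whose values at
  negative arguments are irrelevant.
\<close>

definition L_space :: "(real \<Rightarrow> real) set" where
  "L_space = {f. f \<in> borel_measurable (lebesgue_on {0..}) \<and> f ` {0..} \<subseteq> {0..1}}"

definition C1_space :: "(real \<Rightarrow> real) set" where
  "C1_space = {f. f ` {0..} \<subseteq> {0..1} \<and>
     (\<exists>f'. continuous_on {0..} f' \<and>
           (\<forall>x\<ge>0. (f has_real_derivative f' x) (at x within {0..})))}"

text \<open>
  The summation index is shifted: the summand \<open>k\<close> below is the summand \<open>k + 1\<close> of the usual
  sum over the positive integers, so that \<open>k\<close> is the exponent of \<open>f z\<close>.
\<close>

definition T :: "nat pmf \<Rightarrow> (real \<Rightarrow> real) \<Rightarrow> real \<Rightarrow> real" where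
  "T P f x =
    (if x > 0 then
       1 / x * (\<Sum>k. pmf P (k + 1) *
         (LINT y:{0..x}|lebesgue.
            (LINT z:{0..y}|lebesgue. exp (- z) * z ^ k / fact k) +
            (LINT z:{y..}|lebesgue. exp (- z) * z ^ k / fact k * f z ^ k)))
     else
       (\<Sum>k. pmf P (k + 1) * (LINT z:{0..}|lebesgue. exp (- z) * z ^ k / fact k * f z ^ k)))"

end

theory Submission
  imports Defs
begin

text \<open>
  Writing \<open>G y\<close> for the probability that an edge of cost \<open>y\<close> is blocked, \<open>T P f x\<close> is the average of \<open>G\<close>
  over \<open>{0..x}\<close>. The function \<open>G\<close> is nondecreasing and 1-Lipschitz; in its derivative the summand \<open>k = 0\<close> vanishes
  and the others are at most \<open>y\<close>, so \<open>0 \<le> G y - G 0 \<le> y\<^sup>2\<close>; hence \<open>T P f\<close> is continuously differentiable,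
  with derivative \<open>0\<close> at \<open>0\<close>. As \<open>T P\<close> is monotone and continuous under bounded pointwise limits, its
  iterates on \<open>0\<close> increase to the smallest fixed point.

  Given \<open>k\<close> potential children and threshold \<open>x\<close>, the costs below a vertex are independent and uniform on
  \<open>{0..x}\<close>, and the subtrees of the children are independent of each other and of the mark of the
  vertex. By Fubini the conditional probability that all edges are cut or lead to dead subtrees is
  therefore the \<open>k\<close>-th power of an average over \<open>{0..x}\<close>, which is one application of \<open>T P\<close>. Extinction
  is the increasing union of these events at the root.
\<close>

section \<open>The operator\<close>

lemma erlang_density_1: "0 \<le> z \<Longrightarrow> erlang_density k 1 z = exp (- z) * z ^ k / fact k"
  by (simp add: erlang_density_def)

lemma erlang_density_neg: "z < 0 \<Longrightarrow> erlang_density k l z = 0"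
  by (simp add: erlang_density_def)

text \<open>The factor \<open>z ^ k / fact k\<close> is a single nonnegative term of the series of
  \<open>exp z\<close>.\<close>

lemma erlang_density_1_le_1: "erlang_density k 1 z \<le> 1"
proof (cases "z < 0")
  case False
  have "(\<Sum>i\<in>{k}. z ^ i /\<^sub>R fact i) \<le> (\<Sum>i. z ^ i /\<^sub>R fact i)"
    using False by (intro sum_le_suminf summable_norm_cancel[OF summable_norm_exp]) auto
  also have "\<dots> = exp z"
    using exp_converges[of z] by (simp add: sums_iff)
  finally show ?thesis
    using False by (simp add: erlang_density_1 exp_minus field_simps)
qed (simp add: erlang_density_neg)

text \<open>Raising the order by one multiplies the density by \<open>z / (real k + 1)\<close>. The
  factor \<open>z\<close> gained here is the source of the quadratic bound near 0 in
  \<open>blocked_increment\<close>.\<close>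

lemma erlang_density_1_Suc_le: "0 \<le> z \<Longrightarrow> erlang_density (Suc k) 1 z \<le> z"
proof -
  assume z: "0 \<le> z"
  have "erlang_density (Suc k) 1 z = z / (real k + 1) * erlang_density k 1 z"
    using z by (simp add: erlang_density_1 field_simps)
  also have "\<dots> \<le> z * 1"
    using z erlang_density_1_le_1 by (intro mult_mono) (auto simp: field_simps)
  finally show ?thesis by simp
qed

lemma has_bochner_integral_erlang_density:
  "has_bochner_integral lborel (erlang_density k 1) 1"
  using nn_integral_erlang_ith_moment[of 1 k 0]
  by (intro has_bochner_integral_nn_integral) auto

lemma integrable_erlang_density [simp]:
  "integrable lborel (erlang_density k 1)" "integrable lebesgue (erlang_density k 1)"
  using has_bochner_integral_erlang_density[of k]
  by (auto simp: has_bochner_integral_iff integrable_completion)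

lemma integral_erlang_density [simp]:
  "integral\<^sup>L lborel (erlang_density k 1) = 1" "integral\<^sup>L lebesgue (erlang_density k 1) = 1"
  using has_bochner_integral_erlang_density[of k]
  by (auto simp: has_bochner_integral_iff integral_completion)

section \<open>Series weighted by the shifted law\<close>

lemma sums_pmf: "(\<lambda>k. pmf P k) sums 1"
proof -
  have "(\<Sum>k. ennreal (pmf P k)) = ennreal 1"
    by (simp flip: nn_integral_count_space_nat add: nn_integral_pmf)
  then show ?thesis
    by (intro sums_ennreal[THEN iffD1]) (auto simp: sums_iff)
qed

lemma summable_pmf_Suc: "summable (\<lambda>k. pmf P (k + 1))"
  using sums_pmf[of P] summable_iff_shift[of "pmf P" 1] by (auto simp: sums_iff)

lemma suminf_pmf_Suc: "(\<Sum>k. pmf P (k + 1)) = 1 - pmf P 0"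
  using sums_pmf[of P] suminf_split_initial_segment[of "pmf P" 1] by (auto simp: sums_iff)

lemma summable_pmf_Suc_mult:
  assumes "\<And>k. \<bar>a k\<bar> \<le> (C :: real)"
  shows "summable (\<lambda>k. pmf P (k + 1) * a k)"
proof (rule summable_comparison_test')
  show "summable (\<lambda>k. pmf P (k + 1) * C)"
    using summable_pmf_Suc by (rule summable_mult2)
  show "norm (pmf P (k + 1) * a k) \<le> pmf P (k + 1) * C" for k
    using assms[of k] by (simp add: abs_mult mult_left_mono)
qed

text \<open>The shifted weights have total mass \<open>1 - pmf P 0\<close>. Nonnegativity of
  \<open>a\<close> forces \<open>0 \<le> C\<close>, so that the missing mass can only lower the
  bound.\<close>

lemma suminf_pmf_Suc_mult_le:
  assumes "\<And>k. 0 \<le> a k" "\<And>k. a k \<le> (C :: real)"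
  shows "(\<Sum>k. pmf P (k + 1) * a k) \<le> C"
proof -
  have C: "\<And>k. \<bar>a k\<bar> \<le> C" "0 \<le> C"
    using assms order_trans[OF assms(1)[of 0] assms(2)[of 0]] by auto
  have "(\<Sum>k. pmf P (k + 1) * a k) \<le> (\<Sum>k. pmf P (k + 1) * C)"
    using C assms
    by (intro suminf_le summable_pmf_Suc_mult[where C=C] summable_mult2 summable_pmf_Suc)
       (auto intro: mult_left_mono)
  also have "\<dots> = (1 - pmf P 0) * C"
    using suminf_mult2[OF summable_pmf_Suc[of P], of C] suminf_pmf_Suc[of P] by simp
  also have "\<dots> \<le> C"
    using \<open>0 \<le> C\<close> by (simp add: algebra_simps)
  finally show ?thesis .
qed

section \<open>Blocking probabilities and the formula for the operator\<close>

text \<open>The conditions are imposed on the whole line, so that integrands need no side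
  conditions. Members of \<open>L_space\<close> and \<open>C1_space\<close> enter this class after a
  change at negative arguments, which \<open>T_cong\<close> makes harmless.\<close>

definition unit_fun :: "(real \<Rightarrow> real) \<Rightarrow> bool" where
  "unit_fun f \<longleftrightarrow> f \<in> borel_measurable lebesgue \<and> (\<forall>z. 0 \<le> f z \<and> f z \<le> 1)"

lemma unit_funD:
  assumes "unit_fun f"
  shows "f \<in> borel_measurable lebesgue" "0 \<le> f z" "f z \<le> 1"
    "0 \<le> f z ^ k" "f z ^ k \<le> 1" "\<bar>f z ^ k\<bar> \<le> 1"
  using assms by (auto simp: unit_fun_def power_le_one)

text \<open>
  For a child with \<open>k\<close> potential children and an edge of cost \<open>y\<close>, this is the probability that the
  edge is cut or all \<open>k\<close> edges below the child are blocked; \<open>f z\<close> is the probability that an edge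
  below a vertex with threshold \<open>z\<close> is blocked.
\<close>

definition blocked :: "(real \<Rightarrow> real) \<Rightarrow> nat \<Rightarrow> real \<Rightarrow> real" where
  "blocked f k y = (LINT z:{0..y}|lebesgue. erlang_density k 1 z) +
     (LINT z:{y..}|lebesgue. erlang_density k 1 z * f z ^ k)"

text \<open>The function \<open>G\<close> of the overview: a vertex other than the root has
  \<open>k\<close> potential children with probability \<open>pmf P (k + 1)\<close>.\<close>

definition blocked_prob :: "nat pmf \<Rightarrow> (real \<Rightarrow> real) \<Rightarrow> real \<Rightarrow> real" where
  "blocked_prob P f y = (\<Sum>k. pmf P (k + 1) * blocked f k y)"

text \<open>The gauge integral is used in order to apply the fundamental theorem of calculus;
  \<open>T_cumulative\<close> makes the passage from the Lebesgue integral in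
  \<open>T\<close>.\<close>

definition cumulative_blocked :: "nat pmf \<Rightarrow> (real \<Rightarrow> real) \<Rightarrow> real \<Rightarrow> real" where
  "cumulative_blocked P f x = integral {0..x} (blocked_prob P f)"

lemma blocked_altdef:
  assumes "0 \<le> y"
  shows "(LINT z:{0..y}|lebesgue. exp (- z) * z ^ k / fact k) +
    (LINT z:{y..}|lebesgue. exp (- z) * z ^ k / fact k * f z ^ k) = blocked f k y"
  unfolding blocked_def using assms
  by (intro arg_cong2[where f="(+)"] set_lebesgue_integral_cong) (auto simp: erlang_density_1)

lemma T_pos:
  assumes "0 < x"
  shows "T P f x = 1 / x * (\<Sum>k. pmf P (k + 1) * (LINT y:{0..x}|lebesgue. blocked f k y))"
proof -
  have "(LINT y:{0..x}|lebesgue.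
            (LINT z:{0..y}|lebesgue. exp (- z) * z ^ k / fact k) +
            (LINT z:{y..}|lebesgue. exp (- z) * z ^ k / fact k * f z ^ k)) =
      (LINT y:{0..x}|lebesgue. blocked f k y)" for k
    using blocked_altdef by (intro set_lebesgue_integral_cong) auto
  then show ?thesis using assms by (simp add: T_def)
qed

text \<open>The separate clause of \<open>T\<close> agrees with \<open>G 0\<close>, because at
  \<open>y = 0\<close> the first integral in \<open>blocked\<close> runs over a null set.\<close>

lemma T_nonpos:
  assumes "x \<le> 0"
  shows "T P f x = blocked_prob P f 0"
proof -
  have "AE z in lebesgue. z \<noteq> (0::real)"
    by (rule AE_completion) (rule AE_lborel_singleton)
  then have "(LINT z:{0..0::real}|lebesgue. g z) = 0" for g :: "real \<Rightarrow> real"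
    unfolding set_lebesgue_integral_def by (intro integral_eq_zero_AE) (elim AE_mp, auto simp: indicator_def)
  then show ?thesis
    using assms blocked_altdef[of 0 _ f] by (simp add: T_def blocked_prob_def)
qed

text \<open>Every integral in \<open>T\<close> runs over a part of the nonnegative
  half-line.\<close>

lemma T_cong:
  assumes "\<And>z. 0 \<le> z \<Longrightarrow> f z = g z"
  shows "T P f = T P g"
proof -
  have "blocked f k y = blocked g k y" if "0 \<le> y" for k y
    unfolding blocked_def using that assms
    by (intro arg_cong2[where f="(+)"] set_lebesgue_integral_cong) auto
  moreover from this have "(LINT y:{0..x}|lebesgue. blocked f k y) = (LINT y:{0..x}|lebesgue. blocked g k y)" for k x
    by (intro set_lebesgue_integral_cong) auto
  ultimately have "T P f x = T P g x" for x
    by (cases "0 < x") (simp_all add: T_pos T_nonpos blocked_prob_def)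
  then show ?thesis ..
qed

lemma L_space_unit_fun:
  assumes "f \<in> L_space"
  shows "unit_fun (\<lambda>z. indicator {0..} z * f z)"
  using assms unfolding L_space_def unit_fun_def
  by (subst (asm) borel_measurable_restrict_space_iff)
     (auto simp: indicator_def image_subset_iff)

lemma measurable_erlang_lebesgue [measurable]: "erlang_density k l \<in> borel_measurable lebesgue"
  by (rule measurable_completion) simp

lemma Lipschitz_imp_continuous_on:
  fixes g :: "real \<Rightarrow> real"
  assumes "\<And>y y'. 0 \<le> y \<Longrightarrow> y \<le> y' \<Longrightarrow> 0 \<le> g y' - g y \<and> g y' - g y \<le> y' - y"
  shows "continuous_on {0..} g"
proof (rule lipschitz_on_continuous_on)
  show "1-lipschitz_on {0..} g"
  proof (rule lipschitz_onI)
    show "dist (g x) (g y) \<le> 1 * dist x y" if "x \<in> {0..}" "y \<in> {0..}" for x y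
      using assms[of x y] assms[of y x] that by (auto simp: dist_real_def abs_if)
  qed simp
qed

lemma C1_space_continuous_on:
  assumes "f \<in> C1_space"
  shows "continuous_on {0..} f"
proof -
  obtain f' where "\<And>x. x \<in> {0..} \<Longrightarrow> (f has_real_derivative f' x) (at x within {0..})"
    using assms by (auto simp: C1_space_def)
  then show ?thesis by (rule DERIV_continuous_on)
qed

section \<open>Regularity of the image of a measurable function\<close>

context
  fixes f :: "real \<Rightarrow> real"
  assumes f: "unit_fun f"
begin

lemma integrable_erlang_unit: "integrable lebesgue (\<lambda>z. erlang_density k 1 z * f z ^ m)"
proof (rule Bochner_Integration.integrable_bound[OF integrable_erlang_density(2)[of k]])
  note [measurable] = unit_funD(1)[OF f]
  show "(\<lambda>z. erlang_density k 1 z * f z ^ m) \<in> borel_measurable lebesgue"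
    by measurable
qed (auto simp: abs_mult unit_funD[OF f] intro!: AE_I2 mult_left_le)

lemma integrable_erlang_co: "integrable lebesgue (\<lambda>z. erlang_density k 1 z * (1 - f z ^ k))"
  using Bochner_Integration.integrable_diff[OF integrable_erlang_density(2)[of k] integrable_erlang_unit[of k]]
  by (simp add: algebra_simps)

lemma set_integrable_erlang_co: "A \<in> sets lebesgue \<Longrightarrow>
    set_integrable lebesgue A (\<lambda>z. erlang_density k 1 z * (1 - f z ^ k))"
  unfolding set_integrable_def by (rule integrable_mult_indicator[OF _ integrable_erlang_co])

text \<open>The third bound is what makes \<open>T P f\<close> differentiable at 0. The density with
  \<open>k = 0\<close> equals 1 at the origin, but there the factor \<open>1 - f z ^ 0\<close>
  vanishes; for larger \<open>k\<close> the density itself is at most \<open>z\<close>.\<close>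

lemma erlang_co_bounds:
  "0 \<le> erlang_density k 1 z * (1 - f z ^ k)"
  "erlang_density k 1 z * (1 - f z ^ k) \<le> 1"
  "0 \<le> z \<Longrightarrow> erlang_density k 1 z * (1 - f z ^ k) \<le> z"
proof -
  show "0 \<le> erlang_density k 1 z * (1 - f z ^ k)"
    using unit_funD[OF f] by simp
  have *: "erlang_density k 1 z * (1 - f z ^ k) \<le> erlang_density k 1 z"
    using unit_funD[OF f] by (intro mult_left_le) auto
  then show "erlang_density k 1 z * (1 - f z ^ k) \<le> 1"
    using erlang_density_1_le_1 by (rule order_trans)
  assume z: "0 \<le> z"
  show "erlang_density k 1 z * (1 - f z ^ k) \<le> z"
  proof (cases k)
    case (Suc m)
    show ?thesis
      using order_trans[OF * erlang_density_1_Suc_le[OF z, of m, folded Suc]] .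
  qed (use z in simp)
qed

text \<open>After this rearrangement \<open>y\<close> occurs only as an integration bound, and
  increments in \<open>y\<close> become integrals over short intervals. The two ranges of
  integration in \<open>blocked\<close> overlap in the null set \<open>{y}\<close>.\<close>

lemma blocked_eq:
  assumes "0 \<le> y"
  shows "blocked f k y = (LINT z|lebesgue. erlang_density k 1 z * f z ^ k) +
    (LINT z:{0..y}|lebesgue. erlang_density k 1 z * (1 - f z ^ k))"
proof -
  have int: "integrable lebesgue (\<lambda>z. indicator {0..y} z *\<^sub>R erlang_density k 1 z)"
    "integrable lebesgue (\<lambda>z. indicator {y..} z *\<^sub>R (erlang_density k 1 z * f z ^ k))"
    "integrable lebesgue (\<lambda>z. indicator {0..y} z *\<^sub>R (erlang_density k 1 z * (1 - f z ^ k)))"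
    by (rule integrable_mult_indicator, simp, intro integrable_erlang_density integrable_erlang_unit integrable_erlang_co)+
  have "blocked f k y = (LINT z|lebesgue. indicator {0..y} z *\<^sub>R erlang_density k 1 z +
      indicator {y..} z *\<^sub>R (erlang_density k 1 z * f z ^ k))"
    unfolding blocked_def set_lebesgue_integral_def using int
    by (intro Bochner_Integration.integral_add[symmetric])
  also have "\<dots> = (LINT z|lebesgue. erlang_density k 1 z * f z ^ k +
      indicator {0..y} z *\<^sub>R (erlang_density k 1 z * (1 - f z ^ k)))"
  proof (rule integral_cong_AE)
    have "AE z in lebesgue. z \<noteq> y"
      by (rule AE_completion) (rule AE_lborel_singleton)
    then show "AE z in lebesgue. indicator {0..y} z *\<^sub>R erlang_density k 1 z +
      indicator {y..} z *\<^sub>R (erlang_density k 1 z * f z ^ k) = erlang_density k 1 z * f z ^ k +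
      indicator {0..y} z *\<^sub>R (erlang_density k 1 z * (1 - f z ^ k))"
      by eventually_elim
         (use assms in \<open>auto simp: indicator_def erlang_density_neg algebra_simps\<close>)
  qed (intro borel_measurable_add borel_measurable_integrable int integrable_erlang_unit)+
  also have "\<dots> = (LINT z|lebesgue. erlang_density k 1 z * f z ^ k) +
    (LINT z:{0..y}|lebesgue. erlang_density k 1 z * (1 - f z ^ k))"
    unfolding set_lebesgue_integral_def using int integrable_erlang_unit
    by (intro Bochner_Integration.integral_add)
  finally show ?thesis .
qed

text \<open>By \<open>blocked_eq\<close> the increment is an integral over \<open>{y..y'}\<close>,
  and the three bounds on the integrand in \<open>erlang_co_bounds\<close> give the three claims.
  All are uniform in \<open>k\<close>, so they survive averaging over \<open>k\<close>.\<close>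

lemma blocked_increment:
  assumes "0 \<le> y" "y \<le> y'"
  shows "0 \<le> blocked f k y' - blocked f k y"
    and "blocked f k y' - blocked f k y \<le> y' - y"
    and "blocked f k y' - blocked f k y \<le> y' * (y' - y)"
proof -
  let ?h = "\<lambda>z. erlang_density k 1 z * (1 - f z ^ k)"
  have int: "?h integrable_on {a..b}" "(LINT z:{a..b}|lebesgue. ?h z) = integral {a..b} ?h" for a b
    using set_lebesgue_integral_eq_integral[OF set_integrable_erlang_co[of "{a..b}" k]] by auto
  have eq: "blocked f k y' - blocked f k y = integral {y..y'} ?h"
    using assms Henstock_Kurzweil_Integration.integral_combine[of 0 y y' ?h]
    by (simp add: blocked_eq int)
  show "0 \<le> blocked f k y' - blocked f k y"
    unfolding eq using int erlang_co_bounds by (intro integral_nonneg) auto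
  have le: "integral {y..y'} ?h \<le> c * (y' - y)" if "\<And>z. z \<in> {y..y'} \<Longrightarrow> ?h z \<le> c" for c
  proof -
    have "integral {y..y'} ?h \<le> integral {y..y'} (\<lambda>_. c)"
      using int that by (intro integral_le) auto
    then show ?thesis using assms by (simp add: mult.commute)
  qed
  show "blocked f k y' - blocked f k y \<le> y' - y"
    unfolding eq using le[of 1] erlang_co_bounds(2) by simp
  show "blocked f k y' - blocked f k y \<le> y' * (y' - y)"
    unfolding eq
  proof (rule le)
    fix z assume "z \<in> {y..y'}"
    then show "?h z \<le> y'"
      using erlang_co_bounds(3)[of z k] assms by simp
  qed
qed

lemma blocked_nonneg: "0 \<le> blocked f k y"
  unfolding blocked_def set_lebesgue_integral_def using unit_funD[OF f]
  by (intro add_nonneg_nonneg integral_nonneg) auto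

text \<open>Extending the second integral of \<open>blocked_eq\<close> to the whole line produces
  the total mass of the Erlang density.\<close>

lemma blocked_le_1:
  assumes "0 \<le> y"
  shows "blocked f k y \<le> 1"
proof -
  have "(LINT z:{0..y}|lebesgue. erlang_density k 1 z * (1 - f z ^ k)) \<le>
      (LINT z|lebesgue. erlang_density k 1 z * (1 - f z ^ k))"
    unfolding set_lebesgue_integral_def using erlang_co_bounds
    by (intro integral_mono integrable_mult_indicator integrable_erlang_co) (auto simp: indicator_def)
  also have "\<dots> = 1 - (LINT z|lebesgue. erlang_density k 1 z * f z ^ k)"
    using Bochner_Integration.integral_diff[OF integrable_erlang_density(2)[of k] integrable_erlang_unit[of k]]
    by (simp add: algebra_simps)
  finally show ?thesis by (simp add: blocked_eq assms)
qed

lemma summable_blocked: "0 \<le> y \<Longrightarrow> summable (\<lambda>k. pmf P (k + 1) * blocked f k y)"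
  using blocked_nonneg blocked_le_1 by (intro summable_pmf_Suc_mult[where C=1]) simp

lemma blocked_prob_nonneg: "0 \<le> y \<Longrightarrow> 0 \<le> blocked_prob P f y"
  unfolding blocked_prob_def using blocked_nonneg summable_blocked by (intro suminf_nonneg) auto

lemma blocked_prob_le_1: "0 \<le> y \<Longrightarrow> blocked_prob P f y \<le> 1"
  unfolding blocked_prob_def using blocked_nonneg blocked_le_1 by (intro suminf_pmf_Suc_mult_le) auto

lemma blocked_prob_increment:
  assumes "0 \<le> y" "y \<le> y'"
  shows "0 \<le> blocked_prob P f y' - blocked_prob P f y"
    and "blocked_prob P f y' - blocked_prob P f y \<le> y' - y"
    and "blocked_prob P f y' - blocked_prob P f y \<le> y' * (y' - y)"
proof -
  have eq: "blocked_prob P f y' - blocked_prob P f y =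
      (\<Sum>k. pmf P (k + 1) * (blocked f k y' - blocked f k y))"
    unfolding blocked_prob_def right_diff_distrib
    using assms by (intro suminf_diff summable_blocked) auto
  have "summable (\<lambda>k. pmf P (k + 1) * (blocked f k y' - blocked f k y))"
    unfolding right_diff_distrib using assms by (intro summable_diff summable_blocked) auto
  then show "0 \<le> blocked_prob P f y' - blocked_prob P f y"
    unfolding eq using blocked_increment(1)[OF assms] by (intro suminf_nonneg) auto
  show "blocked_prob P f y' - blocked_prob P f y \<le> y' - y"
    "blocked_prob P f y' - blocked_prob P f y \<le> y' * (y' - y)"
    unfolding eq by (rule suminf_pmf_Suc_mult_le; rule blocked_increment[OF assms])+
qed

lemma continuous_on_blocked: "continuous_on {0..} (blocked f k)"
  using blocked_increment by (intro Lipschitz_imp_continuous_on) auto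

lemma continuous_on_blocked_prob: "continuous_on {0..} (blocked_prob P f)"
  using blocked_prob_increment by (intro Lipschitz_imp_continuous_on) auto

lemma set_integrable_blocked: "set_integrable lebesgue {0..x} (blocked f k)"
  by (rule absolutely_integrable_continuous_real, rule continuous_on_subset[OF continuous_on_blocked]) auto

lemma set_integrable_blocked_prob: "set_integrable lebesgue {0..x} (blocked_prob P f)"
  by (rule absolutely_integrable_continuous_real, rule continuous_on_subset[OF continuous_on_blocked_prob]) auto

lemma set_integral_blocked_bounds:
  assumes "0 \<le> x"
  shows "0 \<le> (LINT y:{0..x}|lebesgue. blocked f k y)" "(LINT y:{0..x}|lebesgue. blocked f k y) \<le> x"
proof -
  show "0 \<le> (LINT y:{0..x}|lebesgue. blocked f k y)"
    unfolding set_lebesgue_integral_def using blocked_nonneg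
    by (intro Bochner_Integration.integral_nonneg) auto
  have "(LINT y:{0..x}|lebesgue. blocked f k y) \<le> (LINT y:{0..x}|lebesgue. 1)"
    using blocked_le_1 set_integrable_blocked by (intro set_integral_mono) auto
  with assms show "(LINT y:{0..x}|lebesgue. blocked f k y) \<le> x"
    by (simp add: set_lebesgue_integral_def)
qed

text \<open>Sum and integral may be interchanged since all terms are nonnegative and the unweighted
  integrals are bounded by \<open>x\<close>.\<close>

lemma T_eq_average:
  assumes "0 < x"
  shows "T P f x = 1 / x * (LINT y:{0..x}|lebesgue. blocked_prob P f y)"
proof -
  let ?g = "\<lambda>k y. indicator {0..x} y *\<^sub>R (pmf P (k + 1) * blocked f k y)"
  have int: "integrable lebesgue (?g k)" for k
    using set_integrable_mult_right[of "pmf P (k + 1)", OF set_integrable_blocked[of x k]]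
    by (simp add: set_integrable_def)
  have norm: "norm (?g k y) = ?g k y" for k y
    using blocked_nonneg by simp
  have eq: "(LINT y|lebesgue. ?g k y) = pmf P (k + 1) * (LINT y:{0..x}|lebesgue. blocked f k y)" for k
    unfolding set_lebesgue_integral_def by (simp flip: integral_mult_right_zero add: mult_ac)
  have "(LINT y|lebesgue. (\<Sum>k. ?g k y)) = (\<Sum>k. (LINT y|lebesgue. ?g k y))"
  proof (rule integral_suminf)
    show "AE y in lebesgue. summable (\<lambda>k. norm (?g k y))"
      unfolding norm using summable_blocked[where P=P]
      by (auto simp: indicator_def intro!: AE_I2)
    show "summable (\<lambda>k. LINT y|lebesgue. norm (?g k y))"
      unfolding norm eq using set_integral_blocked_bounds assms
      by (intro summable_pmf_Suc_mult[where C=x]) auto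
  qed (rule int)
  moreover have "(\<Sum>k. ?g k y) = indicator {0..x} y *\<^sub>R blocked_prob P f y" for y
    by (simp add: indicator_def blocked_prob_def)
  ultimately show ?thesis
    using assms eq by (simp add: T_pos set_lebesgue_integral_def)
qed

lemma T_cumulative: "0 < x \<Longrightarrow> T P f x = cumulative_blocked P f x / x"
  using set_lebesgue_integral_eq_integral(2)[OF set_integrable_blocked_prob[of x P]]
  by (simp add: T_eq_average cumulative_blocked_def)

text \<open>The first two bounds compare the nondecreasing integrand with its values at the
  endpoints; they squeeze the average between \<open>G 0\<close> and \<open>G x\<close>.\<close>

lemma cumulative_bounds:
  assumes "0 \<le> x"
  shows "x * blocked_prob P f 0 \<le> cumulative_blocked P f x"
    and "cumulative_blocked P f x \<le> x * blocked_prob P f x"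
    and "cumulative_blocked P f x \<le> x"
proof -
  have int: "blocked_prob P f integrable_on {0..x}"
    using set_lebesgue_integral_eq_integral(1)[OF set_integrable_blocked_prob] .
  have const: "integral {0..x} (\<lambda>_. c) = x * c" for c :: real
    using assms by simp
  show "x * blocked_prob P f 0 \<le> cumulative_blocked P f x"
    unfolding cumulative_blocked_def const[symmetric]
    using int blocked_prob_increment(1)[of 0] by (intro integral_le) auto
  show "cumulative_blocked P f x \<le> x * blocked_prob P f x"
    unfolding cumulative_blocked_def const[symmetric]
    using int blocked_prob_increment(1)[of _ x] by (intro integral_le) auto
  have "cumulative_blocked P f x \<le> x * 1"
    unfolding cumulative_blocked_def const[symmetric]
    using int blocked_prob_le_1 by (intro integral_le) auto
  then show "cumulative_blocked P f x \<le> x" by simp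
qed

lemma T_bounds: "0 \<le> T P f x" "T P f x \<le> 1"
proof -
  have "0 \<le> T P f x \<and> T P f x \<le> 1"
  proof (cases "0 < x")
    case True
    have "0 \<le> x * blocked_prob P f 0"
      using True blocked_prob_nonneg by simp
    then have "0 \<le> cumulative_blocked P f x" "cumulative_blocked P f x \<le> x"
      using cumulative_bounds[of x P] True by auto
    then show ?thesis
      using True by (simp add: T_cumulative)
  next
    case False
    then show ?thesis using T_nonpos blocked_prob_nonneg blocked_prob_le_1 by simp
  qed
  then show "0 \<le> T P f x" "T P f x \<le> 1" by auto
qed

lemma cumulative_deriv:
  assumes "0 \<le> x"
  shows "(cumulative_blocked P f has_real_derivative blocked_prob P f x) (at x within {0..})"
proof -
  \<comment> \<open>The fundamental theorem of calculus is applied on the compact interval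
    \<open>{0..x+1}\<close>, which coincides with the half-line near \<open>x\<close>.\<close>
  have "(cumulative_blocked P f has_real_derivative blocked_prob P f x) (at x within {0..x+1})"
    unfolding cumulative_blocked_def[abs_def] using assms
    by (intro integral_has_real_derivative continuous_on_subset[OF continuous_on_blocked_prob]) auto
  moreover have "at x within {0..x+1} = at x within {0..}"
    using assms by (intro at_within_nhd[where S="{x-1<..<x+1}"]) auto
  ultimately show ?thesis by simp
qed

text \<open>Away from 0 this is the quotient rule for \<open>cumulative_blocked P f x / x\<close>.
  At 0, the quadratic bound on \<open>G\<close> makes both the difference quotient and the candidate
  \<open>f'\<close> at most the argument in absolute value, which gives the derivative and its
  continuity.\<close>

lemma T_C1_space: "T P f \<in> C1_space"
proof -
  define f' where "f' x = (if x = 0 then 0 else (blocked_prob P f x * x - cumulative_blocked P f x) / (x * x))" for x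
  have quad: "blocked_prob P f x \<le> blocked_prob P f 0 + x * x" if "0 \<le> x" for x
    using blocked_prob_increment(3)[of 0 x P] that by simp
  \<comment> \<open>The numerator of \<open>f' x\<close> lies between 0 and
    \<open>x * (G x - G 0)\<close>, hence is at most \<open>x * (x * x)\<close>; the denominator
    \<open>x * x\<close> leaves \<open>x\<close>.\<close>
  have f'_bound: "norm (f' x) \<le> x" if "0 \<le> x" for x
  proof (cases "x = 0")
    case False
    have "x * blocked_prob P f x \<le> x * (blocked_prob P f 0 + x * x)"
      using quad that by (intro mult_left_mono)
    then have "0 \<le> blocked_prob P f x * x - cumulative_blocked P f x"
        "blocked_prob P f x * x - cumulative_blocked P f x \<le> x * (x * x)"
      using cumulative_bounds[OF that, of P] by (auto simp: algebra_simps)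
    then show ?thesis
      using False that by (auto simp: f'_def field_simps)
  qed (simp add: f'_def)
  have to_0: "((\<lambda>x::real. x) \<longlongrightarrow> 0) (at 0 within {0..})"
    by (rule tendsto_ident_at)
  have deriv: "(T P f has_real_derivative f' x) (at x within {0..})" if "0 \<le> x" for x
  proof (cases "x = 0")
    case True
    have "((\<lambda>y. (T P f y - T P f 0) / (y - 0)) \<longlongrightarrow> 0) (at 0 within {0..})"
    proof (rule Lim_null_comparison[OF _ to_0])
      have "norm ((T P f y - T P f 0) / (y - 0)) \<le> y" if "0 < y" for y
      proof -
        have "cumulative_blocked P f y \<le> y * (blocked_prob P f 0 + y * y)"
          using cumulative_bounds(2)[of y P] quad[of y] that
          by (meson less_imp_le mult_left_mono order_trans)
        then have "cumulative_blocked P f y / y \<le> blocked_prob P f 0 + y * y"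
          "blocked_prob P f 0 \<le> cumulative_blocked P f y / y"
          using cumulative_bounds(1)[of y P] that by (auto simp: field_simps)
        then show ?thesis
          using that by (auto simp: T_cumulative T_nonpos field_simps)
      qed
      then show "\<forall>\<^sub>F y in at 0 within {0..}. norm ((T P f y - T P f 0) / (y - 0)) \<le> y"
        by (auto simp: eventually_at_filter)
    qed
    then show ?thesis
      using True by (simp add: has_field_derivative_iff f'_def)
  next
    case False
    with that have "0 < x" by simp
    have "((\<lambda>y. cumulative_blocked P f y / y) has_real_derivative f' x) (at x within {0..})"
      using DERIV_divide[OF cumulative_deriv[OF that] DERIV_ident False] False by (simp add: f'_def)
    \<comment> \<open>Within distance \<open>x\<close> of \<open>x\<close> all points are positive,
      and there \<open>T_cumulative\<close> applies.\<close>
    then show ?thesis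
      by (rule has_field_derivative_transform_within[OF _ \<open>0 < x\<close>])
         (use that in \<open>auto simp: T_cumulative dist_real_def\<close>)
  qed
  have "continuous_on {0..} f'"
    unfolding continuous_on_eq_continuous_within
  proof
    fix x :: real assume x: "x \<in> {0..}"
    show "continuous (at x within {0..}) f'"
    proof (cases "x = 0")
      case True
      have "(f' \<longlongrightarrow> 0) (at 0 within {0..})"
        by (rule Lim_null_comparison[OF _ to_0]) (use f'_bound in \<open>auto simp: eventually_at_filter intro!: always_eventually\<close>)
      then show ?thesis using True by (simp add: continuous_within f'_def)
    next
      case False
      with x have "0 < x" by simp
      have "continuous_on {0..} (cumulative_blocked P f)"
        by (rule DERIV_continuous_on, rule cumulative_deriv) simp
      then have cont: "continuous_on {0<..} (cumulative_blocked P f)" "continuous_on {0<..} (blocked_prob P f)"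
        using continuous_on_blocked_prob[of P] by (auto elim!: continuous_on_subset)
      have "continuous_on {0<..} (\<lambda>x. (blocked_prob P f x * x - cumulative_blocked P f x) / (x * x))"
        by (intro continuous_intros cont) auto
      then have "continuous_on {0<..} f'"
        by (rule continuous_on_eq) (simp add: f'_def)
      then show ?thesis
        using \<open>0 < x\<close> continuous_on_interior[of "{0<..}" f' x]
        by (auto simp: interior_open intro: continuous_at_imp_continuous_at_within)
    qed
  qed
  then show ?thesis
    using deriv T_bounds by (auto simp: C1_space_def)
qed

lemma T_continuous_on: "continuous_on {0..} (T P f)"
  using T_C1_space by (rule C1_space_continuous_on)

text \<open>Borel rather than Lebesgue measurability will be required when iterates are integrated
  over \<open>lborel\<close>. The function is continuous on the half-line and constant to the left
  of it.\<close>

lemma T_borel: "T P f \<in> borel_measurable borel"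
proof -
  have "T P f = (\<lambda>x. if x \<in> {0..} then T P f x else T P f 0)"
    by (auto simp: fun_eq_iff T_nonpos)
  moreover have "\<dots> \<in> borel_measurable borel"
    by (intro borel_measurable_continuous_on_if T_continuous_on continuous_on_const) auto
  ultimately show ?thesis by simp
qed

lemma T_unit_fun: "unit_fun (T P f)"
  using T_borel T_bounds by (auto simp: unit_fun_def intro!: measurable_completion)

end

lemma C1_space_unit_fun:
  assumes "f \<in> C1_space"
  shows "unit_fun (\<lambda>z. f (max 0 z))"
proof -
  have "continuous_on {0..} f"
    using assms by (rule C1_space_continuous_on)
  then have "continuous_on UNIV (\<lambda>z. f (max 0 z))"
    by (rule continuous_on_compose2) (auto intro!: continuous_intros)
  then show ?thesis
    using assms
    by (auto simp: unit_fun_def C1_space_def image_subset_iff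
        intro!: measurable_completion borel_measurable_continuous_onI)
qed

section \<open>Monotonicity, limits and the smallest fixed point\<close>

lemma T_mono:
  assumes f: "unit_fun f" and g: "unit_fun g" and le: "\<And>z. 0 \<le> z \<Longrightarrow> f z \<le> g z"
  shows "T P f x \<le> T P g x"
proof -
  have blocked: "blocked f k y \<le> blocked g k y" if "0 \<le> y" for k y
    unfolding blocked_def set_lebesgue_integral_def using that le unit_funD[OF f]
    by (intro add_left_mono integral_mono integrable_mult_indicator integrable_erlang_unit f g)
       (auto simp: indicator_def intro!: mult_left_mono power_mono)
  show ?thesis
  proof (cases "0 < x")
    case True
    have "(LINT y:{0..x}|lebesgue. blocked f k y) \<le> (LINT y:{0..x}|lebesgue. blocked g k y)" for k
      using blocked by (intro set_integral_mono set_integrable_blocked f g) auto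
    then have "(\<Sum>k. pmf P (k + 1) * (LINT y:{0..x}|lebesgue. blocked f k y)) \<le>
      (\<Sum>k. pmf P (k + 1) * (LINT y:{0..x}|lebesgue. blocked g k y))"
      using True set_integral_blocked_bounds[OF f] set_integral_blocked_bounds[OF g]
      by (intro suminf_le summable_pmf_Suc_mult[where C=x]) (auto intro!: mult_left_mono)
    then show ?thesis using True by (simp add: T_pos divide_right_mono)
  next
    case False
    have "blocked_prob P f 0 \<le> blocked_prob P g 0"
      unfolding blocked_prob_def using blocked
      by (intro suminf_le summable_blocked f g) (auto intro!: mult_left_mono)
    then show ?thesis using False by (simp add: T_nonpos)
  qed
qed

text \<open>Dominated convergence for series, with majorant
  \<open>pmf P (k + 1) * C\<close>.\<close>

lemma tendsto_suminf_pmf_Suc: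
  fixes a :: "nat \<Rightarrow> nat \<Rightarrow> real"
  assumes "\<And>k. (\<lambda>l. a l k) \<longlonglongrightarrow> b k" and "\<And>l k. \<bar>a l k\<bar> \<le> C"
  shows "(\<lambda>l. \<Sum>k. pmf P (k + 1) * a l k) \<longlonglongrightarrow> (\<Sum>k. pmf P (k + 1) * b k)"
proof -
  have "summable (\<lambda>k. pmf P (k + 1) * C)"
    using summable_pmf_Suc by (rule summable_mult2)
  then show ?thesis
    using assms
    by (intro conjunct2[OF conjunct2[OF tannerys_theorem]])
       (auto intro!: tendsto_intros always_eventually mult_left_mono simp: abs_mult)
qed

lemma unit_fun_LIMSEQ:
  assumes "\<And>l. unit_fun (f l)" "\<And>z. (\<lambda>l. f l z) \<longlonglongrightarrow> g z"
  shows "unit_fun g"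
  unfolding unit_fun_def
proof (intro conjI allI)
  show "g \<in> borel_measurable lebesgue"
    using assms(2) unit_funD(1)[OF assms(1)] by (rule borel_measurable_LIMSEQ_real)
  show "0 \<le> g z" "g z \<le> 1" for z
    using assms unit_funD
    by (auto intro!: LIMSEQ_le_const[OF assms(2)] LIMSEQ_le_const2[OF assms(2)])
qed

lemma tendsto_set_integral_erlang:
  assumes f: "\<And>l. unit_fun (f l)" and lim: "\<And>z. (\<lambda>l. f l z) \<longlonglongrightarrow> g z"
    and A: "A \<in> sets lebesgue"
  shows "(\<lambda>l. LINT z:A|lebesgue. erlang_density k 1 z * f l z ^ m) \<longlonglongrightarrow>
    (LINT z:A|lebesgue. erlang_density k 1 z * g z ^ m)"
  unfolding set_lebesgue_integral_def
proof (rule integral_dominated_convergence)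
  have g: "unit_fun g" using f lim by (rule unit_fun_LIMSEQ)
  note [measurable] = unit_funD(1)[OF f] unit_funD(1)[OF g] measurable_erlang_lebesgue A
  show "(\<lambda>z. indicator A z *\<^sub>R (erlang_density k 1 z * g z ^ m)) \<in> borel_measurable lebesgue"
    "(\<lambda>z. indicator A z *\<^sub>R (erlang_density k 1 z * f l z ^ m)) \<in> borel_measurable lebesgue" for l
    by measurable
  show "integrable lebesgue (erlang_density k 1)" by simp
  show "AE z in lebesgue. (\<lambda>l. indicator A z *\<^sub>R (erlang_density k 1 z * f l z ^ m)) \<longlonglongrightarrow>
      indicator A z *\<^sub>R (erlang_density k 1 z * g z ^ m)"
    by (intro AE_I2 tendsto_intros lim)
  show "AE z in lebesgue. norm (indicator A z *\<^sub>R (erlang_density k 1 z * f l z ^ m)) \<le> erlang_density k 1 z" for l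
    using unit_funD[OF f, of l]
    by (intro AE_I2) (auto simp: indicator_def abs_mult intro!: mult_left_le)
qed

text \<open>For positive \<open>x\<close>, dominated convergence is used three times: in
  \<open>z\<close> with the Erlang density, in \<open>y\<close> with the indicator of
  \<open>{0..x}\<close>, and in the series with the weights times \<open>x\<close> as
  majorant.\<close>

lemma T_LIMSEQ:
  assumes f: "\<And>l. unit_fun (f l)" and lim: "\<And>z. (\<lambda>l. f l z) \<longlonglongrightarrow> g z"
  shows "(\<lambda>l. T P (f l) x) \<longlonglongrightarrow> T P g x"
proof -
  have g: "unit_fun g" using f lim by (rule unit_fun_LIMSEQ)
  have blocked: "(\<lambda>l. blocked (f l) k y) \<longlonglongrightarrow> blocked g k y" for k y
    unfolding blocked_def by (intro tendsto_intros tendsto_set_integral_erlang f lim) simp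
  show ?thesis
  proof (cases "0 < x")
    case True
    have "(\<lambda>l. LINT y:{0..x}|lebesgue. blocked (f l) k y) \<longlonglongrightarrow> (LINT y:{0..x}|lebesgue. blocked g k y)" for k
      unfolding set_lebesgue_integral_def
    proof (rule integral_dominated_convergence[where w="indicator {0..x}"])
      show "(\<lambda>y. indicator {0..x} y *\<^sub>R blocked g k y) \<in> borel_measurable lebesgue"
        "(\<lambda>y. indicator {0..x} y *\<^sub>R blocked (f l) k y) \<in> borel_measurable lebesgue" for l
        using set_integrable_blocked[OF g, of x k] set_integrable_blocked[OF f, of x l k]
        by (auto simp: set_integrable_def)
      show "AE y in lebesgue. norm (indicator {0..x} y *\<^sub>R blocked (f l) k y) \<le> indicator {0..x} y" for l
        using blocked_nonneg[OF f] blocked_le_1[OF f] by (auto simp: indicator_def)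
      show "AE y in lebesgue. (\<lambda>l. indicator {0..x} y *\<^sub>R blocked (f l) k y) \<longlonglongrightarrow>
          indicator {0..x} y *\<^sub>R blocked g k y"
        by (intro AE_I2 tendsto_intros blocked)
    qed (simp add: lmeasurable_iff_integrable[symmetric])
    then have "(\<lambda>l. \<Sum>k. pmf P (k + 1) * (LINT y:{0..x}|lebesgue. blocked (f l) k y)) \<longlonglongrightarrow>
        (\<Sum>k. pmf P (k + 1) * (LINT y:{0..x}|lebesgue. blocked g k y))"
      using True set_integral_blocked_bounds[OF f]
      by (intro tendsto_suminf_pmf_Suc[where C=x]) auto
    then show ?thesis
      unfolding T_pos[OF True] by (intro tendsto_intros)
  next
    case False
    have "(\<lambda>l. blocked_prob P (f l) 0) \<longlonglongrightarrow> blocked_prob P g 0"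
      unfolding blocked_prob_def using blocked_nonneg[OF f] blocked_le_1[OF f]
      by (intro tendsto_suminf_pmf_Suc[where C=1] blocked) auto
    then show ?thesis using False by (simp add: T_nonpos)
  qed
qed

abbreviation (input) T_iter :: "nat pmf \<Rightarrow> nat \<Rightarrow> real \<Rightarrow> real" where
  "T_iter P l \<equiv> (T P ^^ l) (\<lambda>_. 0)"

lemma unit_fun_zero: "unit_fun (\<lambda>_. 0)"
  by (simp add: unit_fun_def)

lemma unit_fun_T_iter: "unit_fun (T_iter P l)"
  by (induction l) (auto simp: unit_fun_zero T_unit_fun)

lemma borel_T_iter: "T_iter P l \<in> borel_measurable borel"
  by (cases l) (auto simp: T_borel unit_fun_T_iter)

lemma T_iter_mono: "T_iter P l x \<le> T_iter P (Suc l) x"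
proof (induction l arbitrary: x)
  case 0
  then show ?case using T_bounds[OF unit_fun_zero] by simp
next
  case (Suc l)
  have "T P (T_iter P l) x \<le> T P (T_iter P (Suc l)) x"
    by (intro T_mono unit_fun_T_iter Suc.IH)
  then show ?case by simp
qed

text \<open>The zero function lies below \<open>f\<close> and \<open>T P\<close> preserves the
  order. Since \<open>f\<close> is controlled only on the half-line, its extension by
  \<open>max 0\<close> stands in for it where a \<open>unit_fun\<close> is required.\<close>

lemma T_iter_le_fixed_point:
  assumes "f \<in> C1_space" "\<And>x. 0 \<le> x \<Longrightarrow> T P f x = f x" "0 \<le> x"
  shows "T_iter P l x \<le> f x"
  using assms(3)
proof (induction l arbitrary: x)
  case 0
  then show ?case using assms(1) by (auto simp: C1_space_def)
next
  case (Suc l)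
  have "T P (T_iter P l) x \<le> T P (\<lambda>z. f (max 0 z)) x"
    using Suc.IH by (intro T_mono unit_fun_T_iter C1_space_unit_fun assms) auto
  also have "T P (\<lambda>z. f (max 0 z)) = T P f"
    by (rule T_cong) auto
  finally show ?case using assms(2) Suc.prems by simp
qed

text \<open>The iterates increase and stay below 1, hence converge. The shifted sequence tends both
  to \<open>q\<close> and, by \<open>T_LIMSEQ\<close>, to \<open>T P q\<close>. Smoothness of
  \<open>q\<close> then follows from its being a value of \<open>T P\<close>.\<close>

lemma T_least_fixed_point:
  obtains q where "q \<in> C1_space" "T P q = q" "\<And>x. (\<lambda>l. T_iter P l x) \<longlonglongrightarrow> q x"
    "\<And>f x. f \<in> C1_space \<Longrightarrow> (\<forall>x\<ge>0. T P f x = f x) \<Longrightarrow> 0 \<le> x \<Longrightarrow> q x \<le> f x"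
proof -
  define q where "q x = lim (\<lambda>l. T_iter P l x)" for x
  have lim: "(\<lambda>l. T_iter P l x) \<longlonglongrightarrow> q x" for x
  proof -
    have inc: "incseq (\<lambda>l. T_iter P l x)"
      by (rule incseq_SucI) (rule T_iter_mono)
    have "\<forall>l. T_iter P l x \<le> 1"
      using unit_funD(3)[OF unit_fun_T_iter] by auto
    with inc obtain L where "(\<lambda>l. T_iter P l x) \<longlonglongrightarrow> L"
      by (rule incseq_convergent)
    then have "convergent (\<lambda>l. T_iter P l x)"
      by (rule convergentI)
    then show ?thesis by (simp add: q_def convergent_LIMSEQ_iff)
  qed
  then have unit: "unit_fun q"
    by (rule unit_fun_LIMSEQ[OF unit_fun_T_iter])
  have "T P q x = q x" for x
    using LIMSEQ_unique[OF T_LIMSEQ[OF unit_fun_T_iter lim] lim[THEN LIMSEQ_Suc, of x, simplified]] .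
  then have fixed: "T P q = q" by auto
  show thesis
  proof (rule that[OF _ fixed lim])
    show "q \<in> C1_space" using T_C1_space[OF unit, of P] fixed by simp
    show "q x \<le> f x" if "f \<in> C1_space" "\<forall>x\<ge>0. T P f x = f x" "0 \<le> x" for f x
      using that T_iter_le_fixed_point[of f P x] by (intro LIMSEQ_le_const2[OF lim]) auto
  qed
qed

section \<open>Extinction as a recursive event\<close>

text \<open>Directed form of \<open>kept_edges\<close> without the restriction to
  \<open>words\<close> and \<open>backbone\<close>; paths that start at the root satisfy that
  restriction by \<open>child_rel_backbone\<close>.\<close>

definition child_rel :: "(nat list \<Rightarrow> nat) \<Rightarrow> (nat list \<Rightarrow> real) \<Rightarrow> (nat list \<Rightarrow> real) \<Rightarrow> nat list rel" where
  "child_rel n v c = {(i, i @ [j]) | i j. 1 \<le> j \<and> j \<le> n i \<and> c (i @ [j]) < v (i @ [j])}"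

lemma child_rel_iff:
  "(a, b) \<in> child_rel n v c \<longleftrightarrow> (\<exists>j. b = a @ [j] \<and> 1 \<le> j \<and> j \<le> n a \<and> c b < v b)"
  by (auto simp: child_rel_def)

lemma length_child_rel: "(u, w) \<in> child_rel n v c ^^ l \<Longrightarrow> length w = length u + l"
  by (induction l arbitrary: w) (auto simp: child_rel_iff)

text \<open>Finiteness matters because \<open>Z\<close> is a \<open>card\<close>, which is 0 for
  infinite sets too.\<close>

lemma finite_child_rel_image: "finite ((child_rel n v c ^^ l) `` {u})"
proof (induction l)
  case (Suc l)
  have "(child_rel n v c ^^ Suc l) `` {u} \<subseteq>
      (\<Union>w\<in>(child_rel n v c ^^ l) `` {u}. (\<lambda>j. w @ [j]) ` {1..n w})"
    by (fastforce simp: child_rel_iff)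
  moreover have "finite \<dots>"
    using Suc by auto
  ultimately show ?case by (rule finite_subset)
qed simp

lemma Nil_in_words [simp]: "[] \<in> words"
  by (simp add: words_def)

lemma append_in_words [simp]: "u @ w \<in> words \<longleftrightarrow> u \<in> words \<and> w \<in> words"
  by (simp add: words_def)

lemma singleton_in_words [simp]: "[j] \<in> words \<longleftrightarrow> 1 \<le> j"
  by (simp add: words_def)

lemma potential_edges_child:
  "(i, i @ [j]) \<in> potential_edges n \<longleftrightarrow> i \<in> words \<and> 1 \<le> j \<and> j \<le> n i"
proof -
  \<comment> \<open>This excludes the reversed edges: one of them could only match if
    \<open>i\<close> were a child of its own child.\<close>
  have "length (i @ [j, j']) \<noteq> length i" for j' by simp
  then show ?thesis
    by (auto simp: potential_edges_def Let_def)
qed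

lemma child_rel_backbone:
  assumes "([], w) \<in> child_rel n v c ^^ l"
  shows "w \<in> words \<and> w \<in> backbone n"
  using assms
proof (induction l arbitrary: w)
  case 0
  then show ?case by (auto simp: backbone_def component_def)
next
  case (Suc l)
  then obtain u j where u: "([], u) \<in> child_rel n v c ^^ l" "w = u @ [j]" "1 \<le> j" "j \<le> n u"
    by (auto simp: child_rel_iff)
  with Suc.IH[of u] have "u \<in> words" "u \<in> backbone n" by auto
  moreover from this u have "(u, w) \<in> potential_edges n"
    by (simp add: potential_edges_child)
  ultimately show ?case
    using u by (auto simp: backbone_def component_def intro: rtrancl_into_rtrancl)
qed

lemma kept_edges_iff:
  "(a, b) \<in> kept_edges n v c \<longleftrightarrow>
    a \<in> words \<and> b \<in> words \<and> a \<in> backbone n \<and> b \<in> backbone n \<and>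
    ((a, b) \<in> child_rel n v c \<or> (b, a) \<in> child_rel n v c)"
  by (auto simp: kept_edges_def Let_def potential_edges_child child_rel_iff)

lemma child_rel_kept:
  assumes "([], w) \<in> child_rel n v c ^^ l"
  shows "([], w) \<in> kept_edges n v c ^^ l"
  using assms
proof (induction l arbitrary: w)
  case (Suc l)
  then obtain u where u: "([], u) \<in> child_rel n v c ^^ l" "(u, w) \<in> child_rel n v c"
    by auto
  moreover have "w \<in> words \<and> w \<in> backbone n" "u \<in> words \<and> u \<in> backbone n"
    using child_rel_backbone Suc.prems u(1) by blast+
  ultimately show ?case
    using Suc.IH[of u] by (auto simp: kept_edges_iff intro!: relcompI)
qed simp

text \<open>A walk may go back up, but an upward step leads to the unique parent and thus undoes the
  last step of the descending path constructed so far. What remains is a descending path no longer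
  than the walk.\<close>

lemma kept_child_rel:
  assumes "([], w) \<in> kept_edges n v c ^^ m"
  shows "([], w) \<in> child_rel n v c ^^ length w \<and> length w \<le> m"
  using assms
proof (induction m arbitrary: w)
  case (Suc m)
  then obtain u where u: "([], u) \<in> kept_edges n v c ^^ m" "(u, w) \<in> kept_edges n v c"
    by auto
  with Suc.IH have IH: "([], u) \<in> child_rel n v c ^^ length u" "length u \<le> m"
    by auto
  from u(2) consider "(u, w) \<in> child_rel n v c" | "(w, u) \<in> child_rel n v c"
    by (auto simp: kept_edges_iff)
  then show ?case
  proof cases
    case 1
    moreover from this have "length w = Suc (length u)"
      by (auto simp: child_rel_iff)
    ultimately show ?thesis
      using IH by (auto intro!: relcompI)
  next
    case 2
    then have "length u = Suc (length w)"
      by (auto simp: child_rel_iff)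
    with IH obtain w' where w': "([], w') \<in> child_rel n v c ^^ length w" "(w', u) \<in> child_rel n v c"
      by auto
    with 2 have "w' = w"
      by (auto simp: child_rel_iff)
    with w' IH \<open>length u = Suc (length w)\<close> show ?thesis by auto
  qed
qed auto

text \<open>Distance from the root is word length: a descending path attains it, and by
  \<open>kept_child_rel\<close> no walk is shorter.\<close>

lemma ewt_level:
  "{u \<in> ewt n v c. graph_dist (kept_edges n v c) [] u = l} = (child_rel n v c ^^ l) `` {[]}"
proof -
  have dist: "graph_dist (kept_edges n v c) [] u = length u" if "([], u) \<in> kept_edges n v c ^^ m" for u m
    unfolding graph_dist_def
  proof (rule Least_equality)
    show "([], u) \<in> kept_edges n v c ^^ length u"
      using kept_child_rel[OF that] child_rel_kept by blast
  qed (use kept_child_rel in blast)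
  have "u \<in> ewt n v c \<longleftrightarrow> (\<exists>m. ([], u) \<in> kept_edges n v c ^^ m)" for u
    by (auto simp: ewt_def component_def rtrancl_power)
  then show ?thesis
    using dist kept_child_rel child_rel_kept length_child_rel by (fastforce simp: set_eq_iff)
qed

lemma Z_eq_0_iff: "Z n v c l = 0 \<longleftrightarrow> (child_rel n v c ^^ l) `` {[]} = {}"
  unfolding Z_def ewt_level using finite_child_rel_image by (metis card_eq_0_iff)

text \<open>
  The recursion starts from vertices without potential children, rather than from the empty event,
  because the term with exponent \<open>0\<close> in \<open>T P (\<lambda>_. 0)\<close> is \<open>1\<close>.  With this choice the conditional
  probability of \<open>dead l\<close> given \<open>k\<close> potential children and threshold \<open>x\<close> is \<open>((T P ^^ l) (\<lambda>_. 0) x) ^ k\<close>.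
\<close>

fun dead :: "nat \<Rightarrow> (nat list \<Rightarrow> nat \<times> real \<times> (nat \<Rightarrow> real)) \<Rightarrow> nat list \<Rightarrow> bool" where
  "dead 0 X i \<longleftrightarrow> fst (X i) = 0"
| "dead (Suc l) X i \<longleftrightarrow> (\<forall>j. 1 \<le> j \<and> j \<le> fst (X i) \<longrightarrow>
      snd (snd (X i)) j < fst (snd (X (i @ [j]))) \<longrightarrow> dead l X (i @ [j]))"

text \<open>The event depends only on the marks at \<open>i\<close> and its descendants.
  Independence of disjoint subtrees is brought in through this fact.\<close>

lemma dead_cong:
  "(\<And>w. w \<in> words \<Longrightarrow> X (i @ w) = Y (i @ w)) \<Longrightarrow> dead l X i = dead l Y i"
proof (induction l arbitrary: i)
  case 0
  from 0[of "[]"] show ?case by simp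
next
  case (Suc l)
  have "dead l X (i @ [j]) = dead l Y (i @ [j])" if "1 \<le> j" for j
  proof (rule Suc.IH)
    show "X ((i @ [j]) @ w) = Y ((i @ [j]) @ w)" if "w \<in> words" for w
      using Suc.prems[of "[j] @ w"] that \<open>1 \<le> j\<close> append_in_words[of "[j]" w] by simp
  qed
  moreover have "X (i @ [j]) = Y (i @ [j])" if "1 \<le> j" for j
    using that Suc.prems[of "[j]"] by simp
  moreover have "X i = Y i" using Suc.prems[of "[]"] by simp
  ultimately show ?case by auto
qed

text \<open>Makes extinction an increasing union. The base case holds since the condition on
  children is vacuous when there are no potential children.\<close>

lemma dead_Suc: "dead l X i \<Longrightarrow> dead (Suc l) X i"
proof (induction l arbitrary: i)
  case (Suc l)
  have "dead (Suc l) X (i @ [j])"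
    if "1 \<le> j" "j \<le> fst (X i)" "snd (snd (X i)) j < fst (snd (X (i @ [j])))" for j
    by (rule Suc.IH) (use that Suc.prems in \<open>auto simp del: One_nat_def\<close>)
  then show ?case
    unfolding dead.simps(2)[of "Suc l"] by blast
qed auto

text \<open>The path is split at its first step, to match the recursion of
  \<open>dead\<close>.\<close>

lemma child_rel_Suc_image_empty:
  "(child_rel n v c ^^ Suc l) `` {i} = {} \<longleftrightarrow>
    (\<forall>j. 1 \<le> j \<and> j \<le> n i \<longrightarrow> c (i @ [j]) < v (i @ [j]) \<longrightarrow> (child_rel n v c ^^ l) `` {i @ [j]} = {})"
proof -
  have "(child_rel n v c ^^ Suc l) `` {i} = (\<Union>u\<in>child_rel n v c `` {i}. (child_rel n v c ^^ l) `` {u})"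
    by (auto simp del: relpow.simps dest: relpow_Suc_D2 intro: relpow_Suc_I2)
  then show ?thesis
    unfolding child_rel_def by blast
qed

text \<open>\<open>dead l\<close> lies between emptiness of generation \<open>l\<close> and of
  generation \<open>Suc l\<close> below \<open>i\<close>: \<open>dead 0\<close> rules out even
  potential children, which is stronger than having no kept edge to a child. Both families therefore
  have the same union over \<open>l\<close>.\<close>

lemma dead_sandwich:
  assumes "\<And>i. fst (X i) = n i" "\<And>i. fst (snd (X i)) = v i"
    and "\<And>i j. 1 \<le> j \<Longrightarrow> j \<le> n i \<Longrightarrow> snd (snd (X i)) j = c (i @ [j])"
  shows "(child_rel n v c ^^ l) `` {i} = {} \<Longrightarrow> dead l X i"
    and "dead l X i \<Longrightarrow> (child_rel n v c ^^ Suc l) `` {i} = {}"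
proof -
  show "(child_rel n v c ^^ l) `` {i} = {} \<Longrightarrow> dead l X i"
  proof (induction l arbitrary: i)
    case (Suc l)
    then show ?case by (subst (asm) child_rel_Suc_image_empty) (auto simp: assms)
  qed simp
  show "dead l X i \<Longrightarrow> (child_rel n v c ^^ Suc l) `` {i} = {}"
  proof (induction l arbitrary: i)
    case (Suc l)
    then show ?case by (subst child_rel_Suc_image_empty) (auto simp: assms simp del: relpow.simps)
  next
    case 0
    then show ?case by (subst child_rel_Suc_image_empty) (simp add: assms)
  qed
qed

lemma extinction_eq_dead:
  "extinction M n v \<zeta> = (\<Union>l. {\<omega> \<in> space M. dead l (\<lambda>i. mark n v \<zeta> i \<omega>) []})"
proof -
  have "(\<exists>l\<ge>1. Z (\<lambda>i. n i \<omega>) (\<lambda>i. v i \<omega>) (\<lambda>i. \<zeta> i \<omega>) l = 0) \<longleftrightarrow>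
      (\<exists>l. dead l (\<lambda>i. mark n v \<zeta> i \<omega>) [])" for \<omega>
    unfolding Z_eq_0_iff
    using dead_sandwich[of "\<lambda>i. mark n v \<zeta> i \<omega>" "\<lambda>i. n i \<omega>" "\<lambda>i. v i \<omega>" "\<lambda>i. \<zeta> i \<omega>" _ "[]"]
    by (fastforce simp: mark_def simp del: relpow.simps)
  then show ?thesis by (auto simp: extinction_def)
qed

section \<open>The law of the recursive event\<close>

text \<open>For positive \<open>x\<close> this is the density of the uniform law on
  \<open>{0..x}\<close>. At \<open>x = 0\<close> it is infinite at a single point and for negative
  \<open>x\<close> it is zero, so averages over nonpositive thresholds are 0.\<close>

definition unif_kernel :: "real \<Rightarrow> real \<Rightarrow> ennreal" where
  "unif_kernel x y = (if 0 \<le> y \<and> y \<le> x then inverse (ennreal x) else 0)"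

lemma measurable_unif_kernel [measurable]:
  "(\<lambda>(x, y). unif_kernel x y) \<in> borel_measurable (borel \<Otimes>\<^sub>M borel)"
  unfolding unif_kernel_def by measurable

definition unif_avg :: "(real \<Rightarrow> ennreal) \<Rightarrow> real \<Rightarrow> ennreal" where
  "unif_avg g x = (\<integral>\<^sup>+y. unif_kernel x y * g y \<partial>lborel)"

lemma measurable_unif_avg [measurable]:
  assumes [measurable]: "g \<in> borel_measurable borel"
  shows "unif_avg g \<in> borel_measurable borel"
  unfolding unif_avg_def[abs_def] by measurable

lemma unif_avg_eq:
  assumes [measurable]: "g \<in> borel_measurable borel"
  shows "unif_avg g x = inverse (ennreal x) * (\<integral>\<^sup>+y. indicator {0..x} y * g y \<partial>lborel)"
  unfolding unif_avg_def
  by (subst nn_integral_cmult[symmetric], measurable)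
     (auto intro!: nn_integral_cong simp: unif_kernel_def indicator_def)

text \<open>For nonpositive \<open>x\<close> both sides are 0, so \<open>mark_law\<close> can be
  rewritten without a case distinction under the integral.\<close>

lemma emeasure_uniform_eq_unif_avg:
  assumes [measurable]: "B \<in> sets borel"
  shows "emeasure (uniform_measure lborel {0..x}) B = unif_avg (indicator B) x"
proof -
  have "emeasure lborel {0..x} = ennreal x"
    by (cases "0 \<le> x") (auto simp: ennreal_neg)
  moreover have "(\<integral>\<^sup>+y. indicator {0..x} y * indicator B y \<partial>lborel) = emeasure lborel ({0..x} \<inter> B)"
    by (simp flip: indicator_inter_arith)
  ultimately show ?thesis
    by (subst emeasure_uniform_measure) (auto simp: unif_avg_eq divide_ennreal_def mult.commute)
qed

lemma unif_avg_indicator_le_1: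
  assumes "B \<in> sets borel"
  shows "unif_avg (indicator B) x \<le> 1"
proof -
  have "emeasure (uniform_measure lborel {0..x}) B \<le> 1"
  proof (cases "0 < x")
    case True
    then interpret prob_space "uniform_measure lborel {0..x}"
      by (intro prob_space_uniform_measure) auto
    show ?thesis by (rule emeasure_le_1)
  next
    case False
    have "emeasure lborel ({0..x} \<inter> B) \<le> emeasure lborel {0..x}"
      using assms by (intro emeasure_mono) auto
    also have "\<dots> = 0" using False by (cases "x = 0") auto
    finally show ?thesis
      using assms by (simp add: emeasure_uniform_measure)
  qed
  then show ?thesis by (simp only: emeasure_uniform_eq_unif_avg[OF assms])
qed

text \<open>The left side is the form in which the law of a threshold appears. Its ranges differ
  from those in \<open>blocked\<close> by null sets and by negative \<open>z\<close>, where the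
  density vanishes; a negative cost \<open>y\<close> thus acts like cost 0.\<close>

lemma nn_integral_blocked:
  assumes f: "unit_fun f" and [measurable]: "f \<in> borel_measurable borel"
  shows "(\<integral>\<^sup>+z. indicator {..y} z * ennreal (erlang_density k 1 z) \<partial>lborel) +
    (\<integral>\<^sup>+z. indicator {y<..} z * ennreal (erlang_density k 1 z * f z ^ k) \<partial>lborel) =
    ennreal (blocked f k (max 0 y))"
proof -
  have AE: "AE z in lborel. z \<noteq> 0 \<and> z \<noteq> y"
    using AE_lborel_singleton[of 0] AE_lborel_singleton[of y] by eventually_elim simp
  have "(\<integral>\<^sup>+z. indicator {..y} z * ennreal (erlang_density k 1 z) \<partial>lborel) =
      (\<integral>\<^sup>+z. ennreal (indicator {0..max 0 y} z *\<^sub>R erlang_density k 1 z) \<partial>lborel)"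
    by (rule nn_integral_cong_AE, use AE in eventually_elim)
       (auto simp: indicator_def erlang_density_neg max_def)
  also have "\<dots> = ennreal (LINT z:{0..max 0 y}|lborel. erlang_density k 1 z)"
    unfolding set_lebesgue_integral_def
    by (intro nn_integral_eq_integral integrable_mult_indicator) auto
  also have "(LINT z:{0..max 0 y}|lborel. erlang_density k 1 z) =
      (LINT z:{0..max 0 y}|lebesgue. erlang_density k 1 z)"
    unfolding set_lebesgue_integral_def by (intro integral_completion[symmetric]) measurable
  finally have 1: "(\<integral>\<^sup>+z. indicator {..y} z * ennreal (erlang_density k 1 z) \<partial>lborel) = \<dots>" .
  have "(\<integral>\<^sup>+z. indicator {y<..} z * ennreal (erlang_density k 1 z * f z ^ k) \<partial>lborel) =
      (\<integral>\<^sup>+z. ennreal (indicator {max 0 y..} z *\<^sub>R (erlang_density k 1 z * f z ^ k)) \<partial>lborel)"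
    by (rule nn_integral_cong_AE, use AE in eventually_elim)
       (auto simp: indicator_def erlang_density_neg max_def)
  also have "\<dots> = ennreal (LINT z:{max 0 y..}|lborel. erlang_density k 1 z * f z ^ k)"
    unfolding set_lebesgue_integral_def
    using integrable_erlang_unit[OF f, of k k] unit_funD[OF f]
    by (intro nn_integral_eq_integral integrable_mult_indicator) (auto simp: integrable_completion)
  also have "(LINT z:{max 0 y..}|lborel. erlang_density k 1 z * f z ^ k) =
      (LINT z:{max 0 y..}|lebesgue. erlang_density k 1 z * f z ^ k)"
    unfolding set_lebesgue_integral_def by (intro integral_completion[symmetric]) measurable
  finally have 2: "(\<integral>\<^sup>+z. indicator {y<..} z * ennreal (erlang_density k 1 z * f z ^ k) \<partial>lborel) = \<dots>" .
  have "0 \<le> (LINT z:{0..max 0 y}|lebesgue. erlang_density k 1 z)"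
    "0 \<le> (LINT z:{max 0 y..}|lebesgue. erlang_density k 1 z * f z ^ k)"
    unfolding set_lebesgue_integral_def using unit_funD[OF f]
    by (intro Bochner_Integration.integral_nonneg; simp)+
  then show ?thesis
    unfolding 1 2 blocked_def by (rule ennreal_plus[symmetric])
qed

text \<open>Composition with \<open>max 0\<close> turns continuity on the half-line into continuity
  on the line, and averages over \<open>{0..x}\<close> do not see the change.\<close>

lemma measurable_blocked_prob_max:
  assumes "unit_fun f"
  shows "(\<lambda>y. blocked_prob P f (max 0 y)) \<in> borel_measurable borel"
  by (rule borel_measurable_continuous_onI,
      rule continuous_on_compose2[OF continuous_on_blocked_prob[OF assms]])
     (auto intro!: continuous_intros)

lemma unif_avg_blocked_prob:
  assumes f: "unit_fun f" and x: "0 < x"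
  shows "unif_avg (\<lambda>y. ennreal (blocked_prob P f (max 0 y))) x = ennreal (T P f x)"
proof -
  note [measurable] = measurable_blocked_prob_max[OF f]
  let ?I = "LINT y:{0..x}|lebesgue. blocked_prob P f y"
  have "(\<integral>\<^sup>+y. indicator {0..x} y * ennreal (blocked_prob P f (max 0 y)) \<partial>lborel) =
    (\<integral>\<^sup>+y. indicator {0..x} y * ennreal (blocked_prob P f (max 0 y)) \<partial>lebesgue)"
    by (intro nn_integral_completion[symmetric])
  also have "\<dots> = (\<integral>\<^sup>+y. ennreal (indicator {0..x} y *\<^sub>R blocked_prob P f y) \<partial>lebesgue)"
    by (intro nn_integral_cong) (auto simp: indicator_def)
  also have "\<dots> = ennreal ?I"
    unfolding set_lebesgue_integral_def
    using set_integrable_blocked_prob[OF f, of x P] blocked_prob_nonneg[OF f]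
    by (intro nn_integral_eq_integral) (auto simp: set_integrable_def indicator_def)
  finally have "unif_avg (\<lambda>y. ennreal (blocked_prob P f (max 0 y))) x = inverse (ennreal x) * ennreal ?I"
    by (simp add: unif_avg_eq)
  also have "\<dots> = ennreal (T P f x)"
    using x by (simp add: inverse_ennreal T_eq_average[OF f] ennreal_mult'[symmetric] divide_inverse)
  finally show ?thesis .
qed

section \<open>Measurability of the recursive event\<close>

abbreviation mark_space :: "(nat \<times> real \<times> (nat \<Rightarrow> real)) measure" where
  "mark_space \<equiv> count_space UNIV \<Otimes>\<^sub>M borel \<Otimes>\<^sub>M (\<Pi>\<^sub>M j\<in>UNIV. borel)"

lemma measurable_mark_components [measurable]:
  assumes [measurable]: "g \<in> N \<rightarrow>\<^sub>M mark_space"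
  shows "(\<lambda>x. fst (g x)) \<in> N \<rightarrow>\<^sub>M count_space UNIV"
    and "(\<lambda>x. fst (snd (g x))) \<in> borel_measurable N"
    and "(\<lambda>x. snd (snd (g x)) j) \<in> borel_measurable N"
proof -
  show "(\<lambda>x. fst (g x)) \<in> N \<rightarrow>\<^sub>M count_space UNIV" "(\<lambda>x. fst (snd (g x))) \<in> borel_measurable N"
    by measurable
  have "(\<lambda>x. snd (snd (g x))) \<in> N \<rightarrow>\<^sub>M (\<Pi>\<^sub>M j\<in>UNIV. borel)"
    by measurable
  then show "(\<lambda>x. snd (snd (g x)) j) \<in> borel_measurable N"
    by (rule measurable_compose[OF _ measurable_component_singleton]) simp
qed

text \<open>The index set \<open>K\<close> may be any set containing the subtree below
  \<open>i\<close>, so that the event can be read in the product over one subtree alone.\<close>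

lemma pred_dead:
  assumes "\<And>w. w \<in> words \<Longrightarrow> i @ w \<in> K"
  shows "Measurable.pred (PiM K (\<lambda>_. mark_space)) (\<lambda>X. dead l X i)"
  using assms
proof (induction l arbitrary: i)
  case 0
  then have "i \<in> K" by (metis Nil_in_words append_Nil2)
  then have [measurable]: "(\<lambda>X. X i) \<in> PiM K (\<lambda>_. mark_space) \<rightarrow>\<^sub>M mark_space"
    by (rule measurable_component_singleton)
  show ?case by simp
next
  case (Suc l)
  then have "i \<in> K" by (metis Nil_in_words append_Nil2)
  then have [measurable]: "(\<lambda>X. X i) \<in> PiM K (\<lambda>_. mark_space) \<rightarrow>\<^sub>M mark_space"
    by (rule measurable_component_singleton)
  have "Measurable.pred (PiM K (\<lambda>_. mark_space)) (\<lambda>X. 1 \<le> j \<and> j \<le> fst (X i) \<longrightarrow>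
      snd (snd (X i)) j < fst (snd (X (i @ [j]))) \<longrightarrow> dead l X (i @ [j]))" for j
  proof (cases "1 \<le> j")
    case True
    then have K: "i @ [j] @ w \<in> K" if "w \<in> words" for w
      using Suc.prems[of "[j] @ w"] that append_in_words[of "[j]" w] by simp
    then have [measurable]: "Measurable.pred (PiM K (\<lambda>_. mark_space)) (\<lambda>X. dead l X (i @ [j]))"
      by (intro Suc.IH) simp
    have "i @ [j] \<in> K" using K[of "[]"] by simp
    then have [measurable]: "(\<lambda>X. X (i @ [j])) \<in> PiM K (\<lambda>_. mark_space) \<rightarrow>\<^sub>M mark_space"
      by (rule measurable_component_singleton)
    show ?thesis by measurable
  qed simp
  then show ?case
    unfolding dead.simps by (rule pred_intros_countable)
qed

section \<open>The joint law of a mark\<close>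

context erlang_weighted_tree
begin

abbreviation X :: "'w \<Rightarrow> nat list \<Rightarrow> nat \<times> real \<times> (nat \<Rightarrow> real)" where
  "X \<omega> \<equiv> \<lambda>i. mark n v \<zeta> i \<omega>"

text \<open>Costs are read off the mark, which is measurable; they agree with
  \<open>\<zeta> (i @ [j])\<close> for the existing potential children.\<close>

abbreviation cost :: "nat list \<Rightarrow> nat \<Rightarrow> 'w \<Rightarrow> real" where
  "cost i j \<omega> \<equiv> snd (snd (mark n v \<zeta> i \<omega>)) j"

lemma measurable_mark [measurable]: "i \<in> words \<Longrightarrow> mark n v \<zeta> i \<in> M \<rightarrow>\<^sub>M mark_space"
  using indep_marks by (auto simp: indep_vars_def)

lemma measurable_mark_parts [measurable]:
  assumes "i \<in> words"
  shows "n i \<in> M \<rightarrow>\<^sub>M count_space UNIV" "v i \<in> borel_measurable M" "cost i j \<in> borel_measurable M"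
  using measurable_mark_components[OF measurable_mark[OF assms]] by (simp_all add: mark_def)

lemma pred_dead_X [measurable]:
  assumes "i \<in> words"
  shows "Measurable.pred M (\<lambda>\<omega>. dead l (X \<omega>) i)"
proof -
  have "(\<lambda>\<omega>. restrict (X \<omega>) words) \<in> M \<rightarrow>\<^sub>M PiM words (\<lambda>_. mark_space)"
    by (intro measurable_restrict measurable_mark)
  moreover have "Measurable.pred (PiM words (\<lambda>_. mark_space)) (\<lambda>X. dead l X i)"
    using assms by (intro pred_dead) simp
  ultimately have "Measurable.pred M (\<lambda>\<omega>. dead l (restrict (X \<omega>) words) i)"
    by (rule measurable_compose)
  moreover have "dead l (restrict (X \<omega>) words) i = dead l (X \<omega>) i" for \<omega>
    using assms by (intro dead_cong) simp
  ultimately show ?thesis by simp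
qed

text \<open>This turns \<open>mark_law\<close> into an identity between nonnegative integrals, the
  form that extends from indicators to functions. Averages of indicators are at most 1, hence
  finite, so nothing is lost between real and extended values.\<close>

lemma mark_law_indicator:
  assumes i: "i \<in> words" and [measurable]: "A \<in> sets borel" "\<And>j. B j \<in> sets borel"
  shows "(\<integral>\<^sup>+\<omega>. indicator {k} (n i \<omega>) * indicator A (v i \<omega>) *
      (\<Prod>j\<in>{1..k}. indicator (B j) (cost i j \<omega>)) \<partial>M) =
    ennreal (potential_prob P i k) * (\<integral>\<^sup>+x. indicator A x * ennreal (erlang_density k 1 x) *
      (\<Prod>j\<in>{1..k}. unif_avg (indicator (B j)) x) \<partial>lborel)"
proof -
  let ?E = "{\<omega> \<in> space M. n i \<omega> = k \<and> v i \<omega> \<in> A \<and> (\<forall>j\<in>{1..k}. \<zeta> (i @ [j]) \<omega> \<in> B j)}"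
  let ?E' = "{\<omega> \<in> space M. n i \<omega> = k \<and> v i \<omega> \<in> A \<and> (\<forall>j\<in>{1..k}. cost i j \<omega> \<in> B j)}"
  let ?m = "\<lambda>x j. enn2real (unif_avg (indicator (B j)) x)"
  note [measurable] = measurable_mark_parts[OF i]
  have "measure (uniform_measure lborel {0..x}) (B j) = ?m x j" for x j
    by (simp only: measure_def emeasure_uniform_eq_unif_avg[OF assms(3)])
  then have E: "prob ?E = potential_prob P i k *
      (LINT x:A|lborel. erlang_density k 1 x * (\<Prod>j\<in>{1..k}. ?m x j))"
    using mark_law[OF i, of A B k] by simp
  have "?E = ?E'" by (auto simp: mark_def)
  have "(\<integral>\<^sup>+\<omega>. indicator {k} (n i \<omega>) * indicator A (v i \<omega>) *
      (\<Prod>j\<in>{1..k}. indicator (B j) (cost i j \<omega>)) \<partial>M) = (\<integral>\<^sup>+\<omega>. indicator ?E' \<omega> \<partial>M)"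
  proof (rule nn_integral_cong)
    fix \<omega> assume "\<omega> \<in> space M"
    have "(\<Prod>j\<in>{1..k}. indicator (B j) (cost i j \<omega>)) =
        (if \<forall>j\<in>{1..k}. cost i j \<omega> \<in> B j then 1 else 0 :: ennreal)"
      by (auto simp: indicator_def)
    then show "indicator {k} (n i \<omega>) * indicator A (v i \<omega>) *
        (\<Prod>j\<in>{1..k}. indicator (B j) (cost i j \<omega>)) = (indicator ?E' \<omega> :: ennreal)"
      using \<open>\<omega> \<in> space M\<close> by (auto simp: indicator_def)
  qed
  also have "\<dots> = emeasure M ?E'"
    by (rule nn_integral_indicator) measurable
  also have "\<dots> = ennreal (prob ?E)"
    by (simp only: \<open>?E = ?E'\<close> emeasure_eq_measure)
  also have "prob ?E = potential_prob P i k *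
      (LINT x:A|lborel. erlang_density k 1 x * (\<Prod>j\<in>{1..k}. ?m x j))"
    by (rule E)
  also have "ennreal \<dots> = ennreal (potential_prob P i k) *
      ennreal (LINT x:A|lborel. erlang_density k 1 x * (\<Prod>j\<in>{1..k}. ?m x j))"
    by (intro ennreal_mult') (simp add: potential_prob_def)
  also have "ennreal (LINT x:A|lborel. erlang_density k 1 x * (\<Prod>j\<in>{1..k}. ?m x j)) =
      (\<integral>\<^sup>+x. ennreal (indicator A x *\<^sub>R (erlang_density k 1 x * (\<Prod>j\<in>{1..k}. ?m x j))) \<partial>lborel)"
    unfolding set_lebesgue_integral_def
  proof (intro nn_integral_eq_integral[symmetric] integrable_mult_indicator)
    have m: "0 \<le> ?m x j" "?m x j \<le> 1" for x j
      using unif_avg_indicator_le_1[of "B j" x] by (auto simp: enn2real_leI)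
    show "integrable lborel (\<lambda>x. erlang_density k 1 x * (\<Prod>j\<in>{1..k}. ?m x j))"
      by (rule Bochner_Integration.integrable_bound[OF integrable_erlang_density(1)[of k]])
         (auto simp: abs_mult abs_prod m intro!: mult_left_le prod_le_1)
  qed (auto intro!: AE_I2 mult_nonneg_nonneg prod_nonneg)
  also have "\<dots> = (\<integral>\<^sup>+x. indicator A x * ennreal (erlang_density k 1 x) *
      (\<Prod>j\<in>{1..k}. unif_avg (indicator (B j)) x) \<partial>lborel)"
  proof (rule nn_integral_cong)
    fix x
    have "unif_avg (indicator (B j)) x = ennreal (?m x j)" for j
      using le_less_trans[OF unif_avg_indicator_le_1[OF assms(3)] ennreal_one_less_top]
      by (simp only: ennreal_enn2real)
    then have "(\<Prod>j\<in>{1..k}. unif_avg (indicator (B j)) x) = (\<Prod>j\<in>{1..k}. ennreal (?m x j))"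
      by (intro prod.cong refl)
    also have "\<dots> = ennreal (\<Prod>j\<in>{1..k}. ?m x j)"
      by (rule prod_ennreal) simp
    finally have "(\<Prod>j\<in>{1..k}. unif_avg (indicator (B j)) x) = ennreal (\<Prod>j\<in>{1..k}. ?m x j)" .
    then show "ennreal (indicator A x *\<^sub>R (erlang_density k 1 x * (\<Prod>j\<in>{1..k}. ?m x j))) =
        indicator A x * ennreal (erlang_density k 1 x) * (\<Prod>j\<in>{1..k}. unif_avg (indicator (B j)) x)"
      by (auto simp: indicator_def ennreal_mult')
  qed
  finally show ?thesis .
qed

text \<open>
  Indicators are replaced by arbitrary functions one coordinate at a time: for \<open>j \<notin> J\<close> the function
  \<open>g j\<close> is still an indicator.
\<close>

lemma mark_law_prod_aux:
  assumes i: "i \<in> words" and A[measurable]: "A \<in> sets borel"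
    and J: "finite J" "J \<subseteq> {1..k}"
    and g: "\<And>j. g j \<in> borel_measurable borel"
      "\<And>j. j \<in> {1..k} - J \<Longrightarrow> \<exists>B\<in>sets borel. g j = indicator B"
  shows "(\<integral>\<^sup>+\<omega>. indicator {k} (n i \<omega>) * indicator A (v i \<omega>) * (\<Prod>j\<in>{1..k}. g j (cost i j \<omega>)) \<partial>M) =
    ennreal (potential_prob P i k) * (\<integral>\<^sup>+x. indicator A x * ennreal (erlang_density k 1 x) *
      (\<Prod>j\<in>{1..k}. unif_avg (g j) x) \<partial>lborel)"
  using J g
proof (induction J arbitrary: g rule: finite_induct)
  case empty
  then have "\<forall>j. \<exists>B\<in>sets borel. j \<in> {1..k} \<longrightarrow> g j = indicator B"
    by blast
  then obtain B where B: "\<And>j. B j \<in> sets borel" "\<And>j. j \<in> {1..k} \<Longrightarrow> g j = indicator (B j)"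
    by metis
  then show ?case
    using mark_law_indicator[OF i A, of B k] by (simp only: B(2) cong: prod.cong)
next
  case (insert j0 J)
  note [measurable] = measurable_mark_parts[OF i] insert.prems(2)
  have j0: "j0 \<in> {1..k}" using insert.prems by auto
  define R where "R \<omega> = indicator {k} (n i \<omega>) * indicator A (v i \<omega>) *
    (\<Prod>j\<in>{1..k} - {j0}. g j (cost i j \<omega>))" for \<omega>
  define W where "W x = ennreal (potential_prob P i k) * (indicator A x * ennreal (erlang_density k 1 x) *
    (\<Prod>j\<in>{1..k} - {j0}. unif_avg (g j) x))" for x
  have "(\<lambda>\<omega>. indicator {k} (n i \<omega>) :: ennreal) \<in> borel_measurable M"
    by (rule measurable_compose[OF measurable_mark_parts(1)[OF i]]) simp
  moreover have "(\<lambda>\<omega>. indicator A (v i \<omega>) :: ennreal) \<in> borel_measurable M"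
    by measurable
  moreover have "(\<lambda>\<omega>. g j (cost i j \<omega>)) \<in> borel_measurable M" for j
    by (rule measurable_compose[OF measurable_mark_parts(3)[OF i] insert.prems(2)])
  ultimately have [measurable]: "R \<in> borel_measurable M"
    unfolding R_def[abs_def]
    by (intro borel_measurable_times_ennreal borel_measurable_prod_ennreal)
  have "unif_avg (g j) \<in> borel_measurable borel" for j
    by (rule measurable_unif_avg) (rule insert.prems(2))
  then have [measurable]: "W \<in> borel_measurable borel"
    unfolding W_def[abs_def]
    by (intro borel_measurable_times_ennreal borel_measurable_prod_ennreal) auto
  \<comment> \<open>Both sides, as functions of \<open>g j0\<close>, are integrals with respect to
    \<open>\<mu>\<close> and \<open>\<nu>\<close>. The induction hypothesis with an indicator in
    place of \<open>g j0\<close> shows that these measures agree on Borel sets, so they give every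
    Borel \<open>g j0\<close> the same integral.\<close>
  define \<mu> where "\<mu> = distr (density M R) borel (cost i j0)"
  define \<nu> where "\<nu> = density lborel (\<lambda>y. \<integral>\<^sup>+x. W x * unif_kernel x y \<partial>lborel)"
  have upd: "(\<Prod>j\<in>{1..k}. F ((g(j0 := u)) j) j) = F u j0 * (\<Prod>j\<in>{1..k} - {j0}. F (g j) j)"
    for F :: "(real \<Rightarrow> ennreal) \<Rightarrow> nat \<Rightarrow> ennreal" and u
    by (subst prod.remove[OF _ j0]) (auto intro!: prod.cong)
  have \<mu>: "(\<integral>\<^sup>+y. u y \<partial>\<mu>) = (\<integral>\<^sup>+\<omega>. indicator {k} (n i \<omega>) * indicator A (v i \<omega>) *
      (\<Prod>j\<in>{1..k}. (g(j0 := u)) j (cost i j \<omega>)) \<partial>M)"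
    if [measurable]: "u \<in> borel_measurable borel" for u
  proof -
    have "(\<integral>\<^sup>+y. u y \<partial>\<mu>) = (\<integral>\<^sup>+\<omega>. R \<omega> * u (cost i j0 \<omega>) \<partial>M)"
      unfolding \<mu>_def by (simp add: nn_integral_distr nn_integral_density)
    also have "\<dots> = (\<integral>\<^sup>+\<omega>. indicator {k} (n i \<omega>) * indicator A (v i \<omega>) *
        (\<Prod>j\<in>{1..k}. (g(j0 := u)) j (cost i j \<omega>)) \<partial>M)"
    proof (rule nn_integral_cong)
      show "R \<omega> * u (cost i j0 \<omega>) = indicator {k} (n i \<omega>) * indicator A (v i \<omega>) *
          (\<Prod>j\<in>{1..k}. (g(j0 := u)) j (cost i j \<omega>))" for \<omega>
        unfolding R_def upd[of "\<lambda>h j. h (cost i j \<omega>)"] by (simp only: mult_ac)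
    qed
    finally show ?thesis .
  qed
  have \<nu>: "(\<integral>\<^sup>+y. u y \<partial>\<nu>) = ennreal (potential_prob P i k) * (\<integral>\<^sup>+x. indicator A x *
      ennreal (erlang_density k 1 x) * (\<Prod>j\<in>{1..k}. unif_avg ((g(j0 := u)) j) x) \<partial>lborel)"
    if [measurable]: "u \<in> borel_measurable borel" for u
  proof -
    have "(\<integral>\<^sup>+y. u y \<partial>\<nu>) = (\<integral>\<^sup>+y. (\<integral>\<^sup>+x. W x * unif_kernel x y * u y \<partial>lborel) \<partial>lborel)"
      unfolding \<nu>_def by (simp add: nn_integral_density nn_integral_multc)
    also have "\<dots> = (\<integral>\<^sup>+x. (\<integral>\<^sup>+y. W x * unif_kernel x y * u y \<partial>lborel) \<partial>lborel)"
      by (rule lborel_pair.Fubini') measurable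
    also have "\<dots> = (\<integral>\<^sup>+x. W x * unif_avg u x \<partial>lborel)"
      unfolding unif_avg_def by (simp add: nn_integral_cmult[symmetric] mult.assoc)
    also have "\<dots> = (\<integral>\<^sup>+x. ennreal (potential_prob P i k) * (indicator A x *
      ennreal (erlang_density k 1 x) * (\<Prod>j\<in>{1..k}. unif_avg ((g(j0 := u)) j) x)) \<partial>lborel)"
    proof (rule nn_integral_cong)
      show "W x * unif_avg u x = ennreal (potential_prob P i k) * (indicator A x *
        ennreal (erlang_density k 1 x) * (\<Prod>j\<in>{1..k}. unif_avg ((g(j0 := u)) j) x))" for x
        unfolding W_def upd[of "\<lambda>h j. unif_avg h x"] by (simp only: mult_ac)
    qed
    also have "\<dots> = ennreal (potential_prob P i k) * (\<integral>\<^sup>+x. indicator A x *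
      ennreal (erlang_density k 1 x) * (\<Prod>j\<in>{1..k}. unif_avg ((g(j0 := u)) j) x) \<partial>lborel)"
    proof (rule nn_integral_cmult)
      have "unif_avg ((g(j0 := u)) j) \<in> borel_measurable borel" for j
        using that by (intro measurable_unif_avg) (simp add: insert.prems(2))
      then show "(\<lambda>x. indicator A x * ennreal (erlang_density k 1 x) *
          (\<Prod>j\<in>{1..k}. unif_avg ((g(j0 := u)) j) x)) \<in> borel_measurable lborel"
        by (intro borel_measurable_times_ennreal borel_measurable_prod_ennreal) auto
    qed
    finally show ?thesis .
  qed
  have "\<mu> = \<nu>"
  proof (rule measure_eqI)
    show "sets \<mu> = sets \<nu>" by (simp add: \<mu>_def \<nu>_def)
    fix B assume "B \<in> sets \<mu>"
    then have B[measurable]: "B \<in> sets borel" by (simp add: \<mu>_def)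
    have "(\<integral>\<^sup>+y. indicator B y \<partial>\<mu>) = (\<integral>\<^sup>+y. indicator B y \<partial>\<nu>)"
      unfolding \<mu>[OF borel_measurable_indicator[OF B]] \<nu>[OF borel_measurable_indicator[OF B]]
      using insert.prems B by (intro insert.IH) auto
    moreover have "B \<in> sets \<mu>" "B \<in> sets \<nu>"
      using B by (simp_all add: \<mu>_def \<nu>_def)
    ultimately show "emeasure \<mu> B = emeasure \<nu> B"
      by simp
  qed
  then show ?case
    using \<mu>[of "g j0"] \<nu>[of "g j0"] by simp
qed

lemma mark_law_prod:
  assumes "i \<in> words" "A \<in> sets borel" "\<And>j. g j \<in> borel_measurable borel"
  shows "(\<integral>\<^sup>+\<omega>. indicator {k} (n i \<omega>) * indicator A (v i \<omega>) * (\<Prod>j\<in>{1..k}. g j (cost i j \<omega>)) \<partial>M) =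
    ennreal (potential_prob P i k) * (\<integral>\<^sup>+x. indicator A x * ennreal (erlang_density k 1 x) *
      (\<Prod>j\<in>{1..k}. unif_avg (g j) x) \<partial>lborel)"
  using assms by (intro mark_law_prod_aux[where J="{1..k}"]) auto

lemma measure_node_sums:
  assumes "i \<in> words" "Measurable.pred M Q"
  shows "(\<Sum>k. emeasure M {\<omega> \<in> space M. n i \<omega> = k \<and> Q \<omega>}) = emeasure M {\<omega> \<in> space M. Q \<omega>}"
proof -
  note [measurable] = measurable_mark_parts[OF assms(1)] assms(2)
  have "(\<Sum>k. emeasure M {\<omega> \<in> space M. n i \<omega> = k \<and> Q \<omega>}) =
      emeasure M (\<Union>k. {\<omega> \<in> space M. n i \<omega> = k \<and> Q \<omega>})"
    by (rule suminf_emeasure) (auto simp: disjoint_family_on_def)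
  also have "(\<Union>k. {\<omega> \<in> space M. n i \<omega> = k \<and> Q \<omega>}) = {\<omega> \<in> space M. Q \<omega>}"
    by auto
  finally show ?thesis .
qed

text \<open>All cost functions are taken to be 1. Their averages are 1 for positive
  \<open>x\<close>, and the density vanishes for negative \<open>x\<close>.\<close>

lemma mark_law_threshold:
  assumes i: "i \<in> words" and [measurable]: "A \<in> sets borel"
  shows "emeasure M {\<omega> \<in> space M. n i \<omega> = k \<and> v i \<omega> \<in> A} =
    ennreal (potential_prob P i k) * (\<integral>\<^sup>+x. indicator A x * ennreal (erlang_density k 1 x) \<partial>lborel)"
proof -
  note [measurable] = measurable_mark_parts[OF i]
  have "emeasure M {\<omega> \<in> space M. n i \<omega> = k \<and> v i \<omega> \<in> A} =
      (\<integral>\<^sup>+\<omega>. indicator {\<omega> \<in> space M. n i \<omega> = k \<and> v i \<omega> \<in> A} \<omega> \<partial>M)"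
    by (rule nn_integral_indicator[symmetric]) measurable
  also have "\<dots> = (\<integral>\<^sup>+\<omega>. indicator {k} (n i \<omega>) * indicator A (v i \<omega>) *
      (\<Prod>j\<in>{1..k}. 1) \<partial>M)"
    by (intro nn_integral_cong) (auto simp: indicator_def)
  also have "\<dots> = ennreal (potential_prob P i k) * (\<integral>\<^sup>+x. indicator A x * ennreal (erlang_density k 1 x) *
      (\<Prod>j\<in>{1..k}. unif_avg (\<lambda>_. 1) x) \<partial>lborel)"
    by (rule mark_law_prod[OF i]) measurable
  also have "(\<integral>\<^sup>+x. indicator A x * ennreal (erlang_density k 1 x) *
      (\<Prod>j\<in>{1..k}. unif_avg (\<lambda>_. 1) x) \<partial>lborel) =
      (\<integral>\<^sup>+x. indicator A x * ennreal (erlang_density k 1 x) \<partial>lborel)"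
  proof (rule nn_integral_cong_AE, use AE_lborel_singleton[of 0] in eventually_elim)
    fix x :: real assume "x \<noteq> 0"
    show "indicator A x * ennreal (erlang_density k 1 x) * (\<Prod>j\<in>{1..k}. unif_avg (\<lambda>_. 1) x) =
        indicator A x * ennreal (erlang_density k 1 x)"
    proof (cases "0 < x")
      case True
      then have "unif_avg (\<lambda>_. 1) x = 1"
        by (simp add: unif_avg_eq inverse_ennreal ennreal_mult'[symmetric])
      then show ?thesis by simp
    qed (use \<open>x \<noteq> 0\<close> in \<open>simp add: erlang_density_neg\<close>)
  qed
  finally show ?thesis .
qed

section \<open>The conditional law of the recursive event\<close>

text \<open>A joint law is stated because conditioning on \<open>v i = x\<close> would be
  conditioning on a null event. The root differs from other vertices only in
  \<open>potential_prob\<close>, so one induction serves all of them.\<close>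

definition dead_law :: "nat \<Rightarrow> bool" where
  "dead_law l \<longleftrightarrow> (\<forall>i\<in>words. \<forall>k. \<forall>A\<in>sets borel.
     emeasure M {\<omega> \<in> space M. n i \<omega> = k \<and> v i \<omega> \<in> A \<and> dead l (X \<omega>) i} =
     ennreal (potential_prob P i k) *
       (\<integral>\<^sup>+x. indicator A x * ennreal (erlang_density k 1 x * T_iter P l x ^ k) \<partial>lborel))"

text \<open>Split by whether the threshold is at most \<open>y\<close>, so that the edge is cut, or
  exceeds it, so that the subtree must be dead. As \<open>i\<close> is not the root, the weights are
  the shifted ones of \<open>blocked_prob\<close>.\<close>

lemma emeasure_child_blocked:
  assumes law: "dead_law l" and i: "i \<in> words" "i \<noteq> []"
  shows "emeasure M {\<omega> \<in> space M. y < v i \<omega> \<longrightarrow> dead l (X \<omega>) i} =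
    ennreal (blocked_prob P (T_iter P l) (max 0 y))"
proof -
  note [measurable] = measurable_mark_parts[OF i(1)] pred_dead_X[OF i(1)]
  note u = unit_fun_T_iter[of l P]
  have "emeasure M {\<omega> \<in> space M. n i \<omega> = k \<and> (y < v i \<omega> \<longrightarrow> dead l (X \<omega>) i)} =
      ennreal (pmf P (k + 1) * blocked (T_iter P l) k (max 0 y))" for k
  proof -
    have "emeasure M {\<omega> \<in> space M. n i \<omega> = k \<and> (y < v i \<omega> \<longrightarrow> dead l (X \<omega>) i)} =
      emeasure M ({\<omega> \<in> space M. n i \<omega> = k \<and> v i \<omega> \<in> {..y}} \<union>
        {\<omega> \<in> space M. n i \<omega> = k \<and> v i \<omega> \<in> {y<..} \<and> dead l (X \<omega>) i})"
      by (rule arg_cong[where f="emeasure M"]) auto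
    also have "\<dots> = emeasure M {\<omega> \<in> space M. n i \<omega> = k \<and> v i \<omega> \<in> {..y}} +
        emeasure M {\<omega> \<in> space M. n i \<omega> = k \<and> v i \<omega> \<in> {y<..} \<and> dead l (X \<omega>) i}"
      by (rule plus_emeasure[symmetric]) auto
    also have "\<dots> = ennreal (pmf P (k + 1)) *
        ((\<integral>\<^sup>+x. indicator {..y} x * ennreal (erlang_density k 1 x) \<partial>lborel) +
         (\<integral>\<^sup>+x. indicator {y<..} x * ennreal (erlang_density k 1 x * T_iter P l x ^ k) \<partial>lborel))"
      using i mark_law_threshold[OF i(1), of "{..y}" k]
        law[unfolded dead_law_def, rule_format, of i "{y<..}" k]
      by (simp add: potential_prob_def distrib_left)
    also have "\<dots> = ennreal (pmf P (k + 1) * blocked (T_iter P l) k (max 0 y))"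
      by (simp only: nn_integral_blocked[OF u borel_T_iter] ennreal_mult'[OF pmf_nonneg])
    finally show ?thesis .
  qed
  then have "emeasure M {\<omega> \<in> space M. y < v i \<omega> \<longrightarrow> dead l (X \<omega>) i} =
      (\<Sum>k. ennreal (pmf P (k + 1) * blocked (T_iter P l) k (max 0 y)))"
    using measure_node_sums[OF i(1), of "\<lambda>\<omega>. y < v i \<omega> \<longrightarrow> dead l (X \<omega>) i"] by simp
  also have "\<dots> = ennreal (blocked_prob P (T_iter P l) (max 0 y))"
    unfolding blocked_prob_def using blocked_nonneg[OF u] summable_blocked[OF u]
    by (intro suminf_ennreal2) auto
  finally show ?thesis .
qed

text \<open>The subtrees of distinct children use disjoint sets of words and are hence independent.
  The costs are fixed numbers here; \<open>dead_law_Suc_integral\<close> puts the random ones in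
  their place.\<close>

lemma emeasure_children_blocked:
  assumes law: "dead_law l" and i: "i \<in> words"
  shows "emeasure M {\<omega> \<in> space M. \<forall>j\<in>{1..k}. c j < v (i @ [j]) \<omega> \<longrightarrow> dead l (X \<omega>) (i @ [j])} =
    (\<Prod>j\<in>{1..k}. ennreal (blocked_prob P (T_iter P l) (max 0 (c j))))"
\<comment> \<open>An intersection over no children would be the whole type rather than
  \<open>space M\<close>, so this case is separate.\<close>
proof (cases "k = 0")
  case True
  then show ?thesis by (simp add: emeasure_space_1)
next
  case False
  define K where "K j = {i @ [j] @ w | w. w \<in> words}" for j
  define B where "B j = {Y \<in> space (PiM (K j) (\<lambda>_. mark_space)).
    c j < fst (snd (Y (i @ [j]))) \<longrightarrow> dead l Y (i @ [j])}" for j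
  let ?E = "\<lambda>j. {\<omega> \<in> space M. c j < v (i @ [j]) \<omega> \<longrightarrow> dead l (X \<omega>) (i @ [j])}"
  have child: "i @ [j] \<in> words" if "j \<in> {1..k}" for j
    using i that by simp
  have indep: "indep_vars (\<lambda>j. PiM (K j) (\<lambda>_. mark_space)) (\<lambda>j \<omega>. restrict (X \<omega>) (K j)) {1..k}"
  proof (rule indep_vars_restrict[OF indep_marks])
    show "K j \<subseteq> words" if "j \<in> {1..k}" for j
      using child[OF that] i by (auto simp: K_def words_def)
    show "disjoint_family_on K {1..k}"
      by (auto simp: disjoint_family_on_def K_def)
  qed
  have B: "B j \<in> sets (PiM (K j) (\<lambda>_. mark_space))" if "j \<in> {1..k}" for j
  proof -
    have "i @ [j] @ [] \<in> K j" unfolding K_def using Nil_in_words by blast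
    then have [measurable]: "(\<lambda>Y. Y (i @ [j])) \<in> PiM (K j) (\<lambda>_. mark_space) \<rightarrow>\<^sub>M mark_space"
      by (intro measurable_component_singleton) simp
    have [measurable]: "Measurable.pred (PiM (K j) (\<lambda>_. mark_space)) (\<lambda>Y. dead l Y (i @ [j]))"
      by (rule pred_dead) (auto simp: K_def)
    show ?thesis unfolding B_def by measurable
  qed
  have preimage: "(\<lambda>\<omega>. restrict (X \<omega>) (K j)) -` B j \<inter> space M = ?E j" if "j \<in> {1..k}" for j
  proof -
    have "restrict (X \<omega>) (K j) \<in> space (PiM (K j) (\<lambda>_. mark_space))" for \<omega>
      by (auto simp: space_PiM space_pair_measure)
    moreover have "dead l (restrict (X \<omega>) (K j)) (i @ [j]) = dead l (X \<omega>) (i @ [j])" for \<omega>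
      by (rule dead_cong) (auto simp: K_def)
    moreover have "restrict (X \<omega>) (K j) (i @ [j]) = X \<omega> (i @ [j])" for \<omega>
      using Nil_in_words by (auto simp: K_def)
    ultimately show ?thesis
      by (auto simp: B_def mark_def)
  qed
  have "{\<omega> \<in> space M. \<forall>j\<in>{1..k}. c j < v (i @ [j]) \<omega> \<longrightarrow> dead l (X \<omega>) (i @ [j])} =
      (\<Inter>j\<in>{1..k}. ?E j)"
  proof -
    have "1 \<in> {1..k}" using False by simp
    then show ?thesis by blast
  qed
  also have "\<dots> = (\<Inter>j\<in>{1..k}. (\<lambda>\<omega>. restrict (X \<omega>) (K j)) -` B j \<inter> space M)"
    using preimage by (intro INF_cong) auto
  also have "prob \<dots> = (\<Prod>j\<in>{1..k}. prob ((\<lambda>\<omega>. restrict (X \<omega>) (K j)) -` B j \<inter> space M))"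
    using False B by (intro indep_varsD_finite[OF indep]) auto
  also have "\<dots> = (\<Prod>j\<in>{1..k}. prob (?E j))"
    using preimage by (intro prod.cong) auto
  also have "\<dots> = (\<Prod>j\<in>{1..k}. blocked_prob P (T_iter P l) (max 0 (c j)))"
  proof (rule prod.cong)
    fix j assume "j \<in> {1..k}"
    then show "prob (?E j) = blocked_prob P (T_iter P l) (max 0 (c j))"
      using emeasure_child_blocked[OF law child, of j "c j"] blocked_prob_nonneg[OF unit_fun_T_iter]
      by (simp add: measure_def)
  qed simp
  finally show ?thesis
    using blocked_prob_nonneg[OF unit_fun_T_iter] by (simp add: emeasure_eq_measure prod_ennreal)
qed

text \<open>By independence the joint law is a product measure; Fubini integrates out
  \<open>V\<close> with \<open>U\<close> frozen at its value.\<close>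

lemma emeasure_pair_indep:
  assumes "indep_var S1 U S2 V" and Q: "Q \<in> sets (S1 \<Otimes>\<^sub>M S2)"
  shows "emeasure M ((\<lambda>\<omega>. (U \<omega>, V \<omega>)) -` Q \<inter> space M) =
    (\<integral>\<^sup>+\<omega>. emeasure M (V -` (Pair (U \<omega>) -` Q) \<inter> space M) \<partial>M)"
proof -
  have UV [measurable]: "U \<in> M \<rightarrow>\<^sub>M S1" "V \<in> M \<rightarrow>\<^sub>M S2"
    and eq: "distr M S1 U \<Otimes>\<^sub>M distr M S2 V = distr M (S1 \<Otimes>\<^sub>M S2) (\<lambda>\<omega>. (U \<omega>, V \<omega>))"
    using assms(1) by (auto simp: indep_var_distribution_eq)
  interpret V: prob_space "distr M S2 V"
    by (rule prob_space_distr) fact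
  have Q': "Q \<in> sets (S1 \<Otimes>\<^sub>M distr M S2 V)" "Q \<in> sets (distr M S1 U \<Otimes>\<^sub>M distr M S2 V)"
    using Q by (simp_all cong: sets_pair_measure_cong)
  have "emeasure M ((\<lambda>\<omega>. (U \<omega>, V \<omega>)) -` Q \<inter> space M) = emeasure (distr M S1 U \<Otimes>\<^sub>M distr M S2 V) Q"
    unfolding eq using Q by (intro emeasure_distr[symmetric]) auto
  also have "\<dots> = (\<integral>\<^sup>+u. emeasure (distr M S2 V) (Pair u -` Q) \<partial>distr M S1 U)"
    by (rule V.emeasure_pair_measure_alt) (rule Q')
  also have "\<dots> = (\<integral>\<^sup>+\<omega>. emeasure (distr M S2 V) (Pair (U \<omega>) -` Q) \<partial>M)"
    using V.measurable_emeasure_Pair[OF Q'(1)] by (intro nn_integral_distr) auto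
  also have "\<dots> = (\<integral>\<^sup>+\<omega>. emeasure M (V -` (Pair (U \<omega>) -` Q) \<inter> space M) \<partial>M)"
    using Q by (intro nn_integral_cong emeasure_distr UV sets_Pair1)
  finally show ?thesis .
qed

text \<open>The mark of \<open>i\<close> and the marks of its proper descendants are independent.
  With the former frozen, the costs are constants and \<open>emeasure_children_blocked\<close>
  applies.\<close>

lemma dead_law_Suc_integral:
  assumes law: "dead_law l" and i: "i \<in> words" and [measurable]: "A \<in> sets borel"
  shows "emeasure M {\<omega> \<in> space M. n i \<omega> = k \<and> v i \<omega> \<in> A \<and> dead (Suc l) (X \<omega>) i} =
    (\<integral>\<^sup>+\<omega>. indicator {k} (n i \<omega>) * indicator A (v i \<omega>) *
      (\<Prod>j\<in>{1..k}. ennreal (blocked_prob P (T_iter P l) (max 0 (cost i j \<omega>)))) \<partial>M)"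
proof -
  define K where "K = {i @ w | w. w \<in> words \<and> w \<noteq> []}"
  let ?S1 = "PiM {i} (\<lambda>_. mark_space)" and ?S2 = "PiM K (\<lambda>_. mark_space)"
  let ?U = "\<lambda>\<omega>. restrict (X \<omega>) {i}" and ?V = "\<lambda>\<omega>. restrict (X \<omega>) K"
  define Q where "Q = {p \<in> space (?S1 \<Otimes>\<^sub>M ?S2). fst (fst p i) = k \<and> fst (snd (fst p i)) \<in> A \<and>
    (\<forall>j\<in>{1..k}. snd (snd (fst p i)) j < fst (snd (snd p (i @ [j]))) \<longrightarrow> dead l (snd p) (i @ [j]))}"
  have K_child: "i @ [j] @ w \<in> K" if "j \<in> {1..k}" "w \<in> words" for j w
    using that append_in_words[of "[j]" w] by (auto simp: K_def)
  have K_child0: "i @ [j] \<in> K" if "j \<in> {1..k}" for j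
    using K_child[OF that Nil_in_words] by simp
  have indep: "indep_var ?S1 ?U ?S2 ?V"
    using i by (intro indep_var_restrict[OF indep_marks]) (auto simp: K_def)
  have [measurable]: "(\<lambda>x. x i) \<in> ?S1 \<rightarrow>\<^sub>M mark_space"
    by (intro measurable_component_singleton) simp
  have Q: "Q \<in> sets (?S1 \<Otimes>\<^sub>M ?S2)"
  proof -
    have "Measurable.pred (?S1 \<Otimes>\<^sub>M ?S2) (\<lambda>(x, y). snd (snd (x i)) j < fst (snd (y (i @ [j]))) \<longrightarrow>
        dead l y (i @ [j]))" if "j \<in> {1..k}" for j
    proof -
      have [measurable]: "(\<lambda>y. y (i @ [j])) \<in> ?S2 \<rightarrow>\<^sub>M mark_space"
        using K_child0[OF that] by (intro measurable_component_singleton)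
      have [measurable]: "Measurable.pred ?S2 (\<lambda>y. dead l y (i @ [j]))"
        using K_child[OF that] by (intro pred_dead) simp
      show ?thesis by measurable
    qed
    then have [measurable]: "Measurable.pred (?S1 \<Otimes>\<^sub>M ?S2) (\<lambda>p. \<forall>j\<in>{1..k}.
        snd (snd (fst p i)) j < fst (snd (snd p (i @ [j]))) \<longrightarrow> dead l (snd p) (i @ [j]))"
      by (intro pred_intros_finite) (auto simp: case_prod_beta')
    show ?thesis unfolding Q_def by measurable
  qed
  have space: "(?U \<omega>, ?V \<omega>') \<in> space (?S1 \<Otimes>\<^sub>M ?S2)" for \<omega> \<omega>'
    by (auto simp: space_PiM space_pair_measure)
  have V: "?V \<omega> (i @ [j]) = X \<omega> (i @ [j])" "dead l (?V \<omega>) (i @ [j]) = dead l (X \<omega>) (i @ [j])"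
    if "j \<in> {1..k}" for \<omega> j
    using K_child0[OF that] K_child[OF that] by (auto intro!: dead_cong)
  \<comment> \<open>Two sample points occur because the sections of \<open>Q\<close> are needed:
    \<open>\<omega>\<close> supplies the mark of \<open>i\<close>, and \<open>\<omega>'\<close> the
    subtrees of the children.\<close>
  have mem: "(?U \<omega>, ?V \<omega>') \<in> Q \<longleftrightarrow> n i \<omega> = k \<and> v i \<omega> \<in> A \<and>
      (\<forall>j\<in>{1..k}. cost i j \<omega> < v (i @ [j]) \<omega>' \<longrightarrow> dead l (X \<omega>') (i @ [j]))" for \<omega> \<omega>'
  proof -
    have "(\<forall>j\<in>{1..k}. cost i j \<omega> < fst (snd (?V \<omega>' (i @ [j]))) \<longrightarrow> dead l (?V \<omega>') (i @ [j])) \<longleftrightarrow>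
        (\<forall>j\<in>{1..k}. cost i j \<omega> < v (i @ [j]) \<omega>' \<longrightarrow> dead l (X \<omega>') (i @ [j]))"
      by (intro ball_cong refl) (simp only: V, simp add: mark_def)
    then show ?thesis
      using space[of \<omega> \<omega>'] by (simp add: Q_def) (simp add: mark_def)
  qed
  have "{\<omega> \<in> space M. n i \<omega> = k \<and> v i \<omega> \<in> A \<and> dead (Suc l) (X \<omega>) i} =
      (\<lambda>\<omega>. (?U \<omega>, ?V \<omega>)) -` Q \<inter> space M"
    using mem by (auto simp: mark_def)
  then have "emeasure M {\<omega> \<in> space M. n i \<omega> = k \<and> v i \<omega> \<in> A \<and> dead (Suc l) (X \<omega>) i} =
      (\<integral>\<^sup>+\<omega>. emeasure M (?V -` (Pair (?U \<omega>) -` Q) \<inter> space M) \<partial>M)"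
    using emeasure_pair_indep[OF indep Q] by simp
  also have "\<dots> = (\<integral>\<^sup>+\<omega>. indicator {k} (n i \<omega>) * indicator A (v i \<omega>) *
      (\<Prod>j\<in>{1..k}. ennreal (blocked_prob P (T_iter P l) (max 0 (cost i j \<omega>)))) \<partial>M)"
  proof (rule nn_integral_cong)
    fix \<omega>
    have "?V -` (Pair (?U \<omega>) -` Q) \<inter> space M = (if n i \<omega> = k \<and> v i \<omega> \<in> A then
        {\<omega>' \<in> space M. \<forall>j\<in>{1..k}. cost i j \<omega> < v (i @ [j]) \<omega>' \<longrightarrow> dead l (X \<omega>') (i @ [j])} else {})"
      unfolding vimage_def mem_Collect_eq mem by auto
    then show "emeasure M (?V -` (Pair (?U \<omega>) -` Q) \<inter> space M) =
      indicator {k} (n i \<omega>) * indicator A (v i \<omega>) *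
      (\<Prod>j\<in>{1..k}. ennreal (blocked_prob P (T_iter P l) (max 0 (cost i j \<omega>))))"
      using emeasure_children_blocked[OF law i, where k=k and c="\<lambda>j. cost i j \<omega>"]
      by (auto simp: indicator_def)
  qed
  finally show ?thesis .
qed

lemma dead_law: "dead_law l"
proof (induction l)
  case 0
  show ?case
    unfolding dead_law_def
  proof safe
    fix i k and A :: "real set"
    assume iA: "i \<in> words" "A \<in> sets borel"
    show "emeasure M {\<omega> \<in> space M. n i \<omega> = k \<and> v i \<omega> \<in> A \<and> dead 0 (X \<omega>) i} =
     ennreal (potential_prob P i k) *
       (\<integral>\<^sup>+x. indicator A x * ennreal (erlang_density k 1 x * T_iter P 0 x ^ k) \<partial>lborel)"
    \<comment> \<open>The factor \<open>T_iter P 0 x ^ k\<close> is \<open>0 ^ k\<close>, that is 1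
      for \<open>k = 0\<close> and 0 otherwise, in accordance with \<open>dead 0\<close>.\<close>
    proof (cases "k = 0")
      case True
      have "{\<omega> \<in> space M. n i \<omega> = k \<and> v i \<omega> \<in> A \<and> dead 0 (X \<omega>) i} =
          {\<omega> \<in> space M. n i \<omega> = k \<and> v i \<omega> \<in> A}"
        using True by (auto simp: mark_def)
      then show ?thesis
        using mark_law_threshold[OF iA, of k] True by simp
    next
      case False
      then have empty: "{\<omega> \<in> space M. n i \<omega> = k \<and> v i \<omega> \<in> A \<and> dead 0 (X \<omega>) i} = {}"
        by (auto simp: mark_def)
      show ?thesis unfolding empty using False by (simp add: power_0_left)
    qed
  qed
next
  case (Suc l)
  show ?case
    unfolding dead_law_def
  proof safe
    fix i k and A :: "real set"
    assume iA: "i \<in> words" "A \<in> sets borel"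
    note u = unit_fun_T_iter[of l P]
    let ?g = "\<lambda>y. ennreal (blocked_prob P (T_iter P l) (max 0 y))"
    have "emeasure M {\<omega> \<in> space M. n i \<omega> = k \<and> v i \<omega> \<in> A \<and> dead (Suc l) (X \<omega>) i} =
      (\<integral>\<^sup>+\<omega>. indicator {k} (n i \<omega>) * indicator A (v i \<omega>) * (\<Prod>j\<in>{1..k}. ?g (cost i j \<omega>)) \<partial>M)"
      by (rule dead_law_Suc_integral[OF Suc.IH iA])
    also have "\<dots> = ennreal (potential_prob P i k) * (\<integral>\<^sup>+x. indicator A x * ennreal (erlang_density k 1 x) *
      (\<Prod>j\<in>{1..k}. unif_avg ?g x) \<partial>lborel)"
      by (rule mark_law_prod[OF iA]) (use measurable_blocked_prob_max[OF u] in measurable)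
    also have "(\<integral>\<^sup>+x. indicator A x * ennreal (erlang_density k 1 x) * (\<Prod>j\<in>{1..k}. unif_avg ?g x) \<partial>lborel) =
      (\<integral>\<^sup>+x. indicator A x * ennreal (erlang_density k 1 x * T_iter P (Suc l) x ^ k) \<partial>lborel)"
    proof (rule nn_integral_cong_AE, use AE_lborel_singleton[of 0] in eventually_elim)
      fix x :: real assume "x \<noteq> 0"
      show "indicator A x * ennreal (erlang_density k 1 x) * (\<Prod>j\<in>{1..k}. unif_avg ?g x) =
        indicator A x * ennreal (erlang_density k 1 x * T_iter P (Suc l) x ^ k)"
      proof (cases "0 < x")
        case True
        then show ?thesis
          using T_bounds[OF u]
          by (simp add: unif_avg_blocked_prob[OF u] ennreal_power ennreal_mult' mult.assoc)
      qed (use \<open>x \<noteq> 0\<close> in \<open>simp add: erlang_density_neg\<close>)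
    qed
    finally show "emeasure M {\<omega> \<in> space M. n i \<omega> = k \<and> v i \<omega> \<in> A \<and> dead (Suc l) (X \<omega>) i} =
      ennreal (potential_prob P i k) *
       (\<integral>\<^sup>+x. indicator A x * ennreal (erlang_density k 1 x * T_iter P (Suc l) x ^ k) \<partial>lborel)" .
  qed
qed

section \<open>The probability of extinction\<close>

text \<open>The root has \<open>k\<close> potential children with probability
  \<open>pmf P k\<close>, unshifted, so order and exponent are both the argument of
  \<open>pmf P\<close>; the term with index 0 vanishes by \<open>P0\<close>.\<close>

lemma prob_dead_root:
  assumes P0: "pmf P 0 = 0"
  shows "prob {\<omega> \<in> space M. dead l (X \<omega>) []} =
    (\<Sum>k. pmf P (k + 1) * (LINT x:UNIV|lebesgue. erlang_density (k + 1) 1 x * T_iter P l x ^ (k + 1)))"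
proof -
  note u = unit_fun_T_iter[of l P]
  let ?I = "\<lambda>k. LINT x:UNIV|lebesgue. erlang_density k 1 x * T_iter P l x ^ k"
  have int: "integrable lebesgue (\<lambda>x. erlang_density k 1 x * T_iter P l x ^ k)" for k
    by (rule integrable_erlang_unit[OF u])
  have I: "0 \<le> ?I k" "?I k \<le> 1" for k
  proof -
    show "0 \<le> ?I k"
      unfolding set_lebesgue_integral_def using unit_funD[OF u]
      by (intro Bochner_Integration.integral_nonneg) simp
    have "?I k \<le> (LINT x|lebesgue. erlang_density k 1 x)"
      unfolding set_lebesgue_integral_def using int[of k] unit_funD[OF u]
      by (intro integral_mono) (auto intro: mult_left_le)
    then show "?I k \<le> 1" by simp
  qed
  have node: "emeasure M {\<omega> \<in> space M. n [] \<omega> = k \<and> dead l (X \<omega>) []} = ennreal (pmf P k * ?I k)" for k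
  proof -
    have "emeasure M {\<omega> \<in> space M. n [] \<omega> = k \<and> v [] \<omega> \<in> UNIV \<and> dead l (X \<omega>) []} =
      ennreal (pmf P k) * (\<integral>\<^sup>+x. indicator UNIV x * ennreal (erlang_density k 1 x * T_iter P l x ^ k) \<partial>lborel)"
      using dead_law[of l, unfolded dead_law_def, rule_format, of "[]" UNIV k] by (simp add: potential_prob_def)
    also have "(\<integral>\<^sup>+x. indicator UNIV x * ennreal (erlang_density k 1 x * T_iter P l x ^ k) \<partial>lborel) =
        (\<integral>\<^sup>+x. ennreal (erlang_density k 1 x * T_iter P l x ^ k) \<partial>lebesgue)"
      using borel_T_iter by (subst nn_integral_completion) auto
    also have "\<dots> = ennreal (?I k)"
      unfolding set_lebesgue_integral_def using int[of k] unit_funD[OF u]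
      by (subst nn_integral_eq_integral) auto
    finally show ?thesis
      by (simp add: ennreal_mult')
  qed
  have "summable (\<lambda>k. pmf P (k + 1) * ?I (k + 1))"
  proof (rule summable_pmf_Suc_mult)
    show "\<bar>?I (k + 1)\<bar> \<le> 1" for k
      using I[of "k + 1"] by (simp only: abs_of_nonneg)
  qed
  then have sum: "summable (\<lambda>k. pmf P k * ?I k)"
    using summable_iff_shift[of "\<lambda>k. pmf P k * ?I k" 1] by simp
  have "ennreal (prob {\<omega> \<in> space M. dead l (X \<omega>) []}) = emeasure M {\<omega> \<in> space M. dead l (X \<omega>) []}"
    by (rule emeasure_eq_measure[symmetric])
  also have "\<dots> = (\<Sum>k. ennreal (pmf P k * ?I k))"
    using measure_node_sums[OF Nil_in_words pred_dead_X[OF Nil_in_words, of l]] by (simp only: node)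
  also have "\<dots> = ennreal (\<Sum>k. pmf P k * ?I k)"
    using I sum by (intro suminf_ennreal2) auto
  finally have "prob {\<omega> \<in> space M. dead l (X \<omega>) []} = (\<Sum>k. pmf P k * ?I k)"
    using I sum by (simp add: suminf_nonneg)
  also have "\<dots> = (\<Sum>k. pmf P (k + 1) * ?I (k + 1))"
    using suminf_split_initial_segment[OF sum, of 1] P0 by simp
  finally show ?thesis .
qed

text \<open>The same sequence of probabilities has two limits: continuity from below gives the
  probability of the union, and dominated convergence in \<open>prob_dead_root\<close> gives the
  series with \<open>q\<close>.\<close>

lemma extinction_probability:
  assumes P0: "pmf P 0 = 0" and q: "\<And>x. (\<lambda>l. T_iter P l x) \<longlonglongrightarrow> q x"
  shows "extinction M n v \<zeta> \<in> events"
    and "prob (extinction M n v \<zeta>) = (\<Sum>m. pmf P (m + 1) *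
      (LINT x:{0..}|lebesgue. exp (- x) * x ^ (m + 1) / fact (m + 1) * q x ^ (m + 1)))"
proof -
  let ?D = "\<lambda>l. {\<omega> \<in> space M. dead l (X \<omega>) []}"
  let ?I = "\<lambda>g k. LINT x:UNIV|lebesgue. erlang_density (k + 1) 1 x * g x ^ (k + 1)"
  have D: "range ?D \<subseteq> events"
    using pred_dead_X[of "[]"] by (auto simp: pred_def)
  then show "extinction M n v \<zeta> \<in> events"
    unfolding extinction_eq_dead by blast
  have "incseq ?D"
    by (rule incseq_SucI) (use dead_Suc in blast)
  then have "(\<lambda>l. prob (?D l)) \<longlonglongrightarrow> prob (extinction M n v \<zeta>)"
    unfolding extinction_eq_dead using D by (intro finite_Lim_measure_incseq)
  moreover have "(\<lambda>l. prob (?D l)) \<longlonglongrightarrow> (\<Sum>k. pmf P (k + 1) * ?I q k)"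
    unfolding prob_dead_root[OF P0]
  proof (rule tendsto_suminf_pmf_Suc)
    show "(\<lambda>l. ?I (T_iter P l) k) \<longlonglongrightarrow> ?I q k" for k
      by (intro tendsto_set_integral_erlang unit_fun_T_iter q) simp
    have "\<bar>?I (T_iter P l) k\<bar> \<le> (LINT x|lebesgue. erlang_density (k + 1) 1 x)" for l k
      unfolding set_lebesgue_integral_def using unit_funD[OF unit_fun_T_iter[of _ P]]
      by (intro integral_abs_bound_integral integrable_mult_indicator integrable_erlang_unit unit_fun_T_iter)
         (auto simp: abs_mult simp del: power_Suc intro!: mult_left_le)
    then show "\<bar>?I (T_iter P l) k\<bar> \<le> 1" for l k
      by simp
  qed
  ultimately have "prob (extinction M n v \<zeta>) = (\<Sum>k. pmf P (k + 1) * ?I q k)"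
    by (rule LIMSEQ_unique)
  moreover have "?I q k = (LINT x:{0..}|lebesgue. exp (- x) * x ^ (k + 1) / fact (k + 1) * q x ^ (k + 1))" for k
    unfolding set_lebesgue_integral_def
    by (intro Bochner_Integration.integral_cong) (auto simp: indicator_def erlang_density_def)
  ultimately show "prob (extinction M n v \<zeta>) = (\<Sum>m. pmf P (m + 1) *
      (LINT x:{0..}|lebesgue. exp (- x) * x ^ (m + 1) / fact (m + 1) * q x ^ (m + 1)))"
    by simp
qed

end

theorem theorem5p2:
  fixes M :: "'w measure"
    and P :: "nat pmf"
    and n :: "nat list \<Rightarrow> 'w \<Rightarrow> nat"
    and v \<zeta> :: "nat list \<Rightarrow> 'w \<Rightarrow> real"
  assumes "pmf P 0 = 0"
    and "integrable (measure_pmf P) real"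
    and "pmf P 1 < 1"
    and "erlang_weighted_tree M P n v \<zeta>"
  shows "(\<forall>f\<in>L_space. T P f \<in> C1_space) \<and>
    (\<exists>q\<in>C1_space.
       (\<forall>x\<ge>0. T P q x = q x) \<and>
       (\<forall>f\<in>C1_space. (\<forall>x\<ge>0. T P f x = f x) \<longrightarrow> (\<forall>x\<ge>0. q x \<le> f x)) \<and>
       (\<forall>x\<ge>0. (\<lambda>l. (T P ^^ l) (\<lambda>_. 0) x) \<longlonglongrightarrow> q x) \<and>
       extinction M n v \<zeta> \<in> sets M \<and>
       measure M (extinction M n v \<zeta>) =
         (\<Sum>m. pmf P (m + 1) *
            (LINT x:{0..}|lebesgue. exp (- x) * x ^ (m + 1) / fact (m + 1) * q x ^ (m + 1))))"
proof
  show "\<forall>f\<in>L_space. T P f \<in> C1_space"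
  proof
    fix f assume "f \<in> L_space"
    \<comment> \<open>Members of \<open>L_space\<close> are unconstrained at negative arguments; the
      cut-off function is a \<open>unit_fun\<close> with the same image under
      \<open>T P\<close>.\<close>
    then have "T P (\<lambda>z. indicator {0..} z * f z) \<in> C1_space"
      by (intro T_C1_space L_space_unit_fun)
    also have "T P (\<lambda>z. indicator {0..} z * f z) = T P f"
      by (rule T_cong) simp
    finally show "T P f \<in> C1_space" .
  qed
  interpret erlang_weighted_tree M P n v \<zeta> by fact
  obtain q where q: "q \<in> C1_space" "T P q = q" "\<And>x. (\<lambda>l. T_iter P l x) \<longlonglongrightarrow> q x"
    "\<And>f x. f \<in> C1_space \<Longrightarrow> (\<forall>x\<ge>0. T P f x = f x) \<Longrightarrow> 0 \<le> x \<Longrightarrow> q x \<le> f x"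
    by (rule T_least_fixed_point[of P]) blast
  show "\<exists>q\<in>C1_space.
       (\<forall>x\<ge>0. T P q x = q x) \<and>
       (\<forall>f\<in>C1_space. (\<forall>x\<ge>0. T P f x = f x) \<longrightarrow> (\<forall>x\<ge>0. q x \<le> f x)) \<and>
       (\<forall>x\<ge>0. (\<lambda>l. (T P ^^ l) (\<lambda>_. 0) x) \<longlonglongrightarrow> q x) \<and>
       extinction M n v \<zeta> \<in> sets M \<and>
       measure M (extinction M n v \<zeta>) =
         (\<Sum>m. pmf P (m + 1) *
            (LINT x:{0..}|lebesgue. exp (- x) * x ^ (m + 1) / fact (m + 1) * q x ^ (m + 1)))"
    using q extinction_probability[OF assms(1) q(3)] by (intro bexI[of _ q]) auto
qed

end
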